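(* Let $0<p\leq 1$, let $X$ be a $p$-Banach space with the separable complementation property and with density character $\aleph_1$, let $\aleph$ be a cardinal, and let $Q:\ell_p(\aleph)\to X$ be a quotient map. Then $\ker Q$ is (isomorphic to) a complemented subspace of a $p$-Banach space with the separable complementation property.
   Context: Scalars are real. A $p$-norm ($0<p\le1$) is a quasinorm satisfying $\|x+y\|^p\le\|x\|^p+\|y\|^p$; a $p$-Banach space is a complete $p$-normed space (a Banach space when $p=1$). $\ell_p(\aleph)$ is the space of functions $x:\aleph\to\mathbb R$ with $\|x\|_p=\left(\sum_{i\in\aleph}|x(i)|^p\right)^{1/p}<\infty$. The density character of a quasinormed space is the minimal cardinality of a dense subset; $\aleph_1$ is the first uncountable cardinal. A quotient map is a bounded linear surjection between (quasi-)Banach spaces. A subspace is complemented if it is the range of a bounded linear projection. A $p$-Banach space has the separable complementation property (SCP) if every separable subspace is contained in a separable complemented subspace. *)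

theory Defs
  imports "HOL-Analysis.Analysis" "HOL-Library.Function_Algebras"
begin

unbundle cardinal_syntax

instantiation "fun" :: (type, real_vector) real_vector
begin

definition "a *\<^sub>R f = (\<lambda>x. a *\<^sub>R f x)"

instance
  by standard
    (simp_all add: scaleR_fun_def fun_eq_iff scaleR_add_right scaleR_add_left)

end

(* Quasinormed spaces are pairs of a linear subspace V of an ambient real vector space and a
   function N; only the values of N on V matter. *)

definition p_normed :: "real \<Rightarrow> 'a::real_vector set \<Rightarrow> ('a \<Rightarrow> real) \<Rightarrow> bool" where
  "p_normed p V N \<longleftrightarrow>
     subspace V \<and>
     (\<forall>x\<in>V. 0 \<le> N x \<and> (N x = 0 \<longleftrightarrow> x = 0)) \<and>
     (\<forall>a. \<forall>x\<in>V. N (a *\<^sub>R x) = \<bar>a\<bar> * N x) \<and>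
     (\<forall>x\<in>V. \<forall>y\<in>V. N (x + y) powr p \<le> N x powr p + N y powr p)"

(* The p-th power of a p-norm induces a metric. The value 0 off V is there because
   Metric_space asks for nonnegativity and symmetry on the whole type. *)
definition pdist :: "real \<Rightarrow> 'a::real_vector set \<Rightarrow> ('a \<Rightarrow> real) \<Rightarrow> 'a \<Rightarrow> 'a \<Rightarrow> real" where
  "pdist p V N x y = (if x \<in> V \<and> y \<in> V then N (x - y) powr p else 0)"

lemma p_normed_Metric_space:
  assumes "p_normed p V N"
  shows "Metric_space V (pdist p V N)"
proof
  have V: "subspace V"
    and zero: "\<forall>x\<in>V. 0 \<le> N x \<and> (N x = 0 \<longleftrightarrow> x = 0)"
    and scale: "\<forall>a. \<forall>x\<in>V. N (a *\<^sub>R x) = \<bar>a\<bar> * N x"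
    and tri: "\<forall>x\<in>V. \<forall>y\<in>V. N (x + y) powr p \<le> N x powr p + N y powr p"
    using assms by (simp_all add: p_normed_def)
  have d: "x - y \<in> V" if "x \<in> V" "y \<in> V" for x y
    using V that by (rule subspace_diff)
  show "0 \<le> pdist p V N x y" for x y by (simp add: pdist_def)
  show "pdist p V N x y = pdist p V N y x" for x y
  proof (cases "x \<in> V \<and> y \<in> V")
    case True
    then show ?thesis
      using scale[rule_format, OF d, of x y "-1"] by (simp add: pdist_def)
  next
    case False
    then show ?thesis by (simp only: pdist_def if_False conj_commute)
  qed
  show "pdist p V N x y = 0 \<longleftrightarrow> x = y" if "x \<in> V" "y \<in> V" for x y
    using zero[rule_format, OF d[OF that]] that by (simp add: pdist_def)
  show "pdist p V N x z \<le> pdist p V N x y + pdist p V N y z"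
    if "x \<in> V" "y \<in> V" "z \<in> V" for x y z
    using tri[rule_format, OF d[OF that(1,2)] d[OF that(2,3)]] that by (simp add: pdist_def)
qed

definition p_topology :: "real \<Rightarrow> 'a::real_vector set \<Rightarrow> ('a \<Rightarrow> real) \<Rightarrow> 'a topology" where
  "p_topology p V N = Metric_space.mtopology V (pdist p V N)"

definition p_banach :: "real \<Rightarrow> 'a::real_vector set \<Rightarrow> ('a \<Rightarrow> real) \<Rightarrow> bool" where
  "p_banach p V N \<longleftrightarrow> p_normed p V N \<and> Metric_space.mcomplete V (pdist p V N)"

definition has_density_character ::
    "real \<Rightarrow> 'a::real_vector set \<Rightarrow> ('a \<Rightarrow> real) \<Rightarrow> 'k rel \<Rightarrow> bool" where
  "has_density_character p V N \<kappa> \<longleftrightarrow>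
     (\<exists>D\<subseteq>V. p_topology p V N closure_of D = V \<and> |D| =o \<kappa>) \<and>
     (\<forall>D\<subseteq>V. p_topology p V N closure_of D = V \<longrightarrow> \<kappa> \<le>o |D| )"

definition bounded_linear_on ::
    "'a::real_vector set \<Rightarrow> ('a \<Rightarrow> real) \<Rightarrow> 'b::real_vector set \<Rightarrow> ('b \<Rightarrow> real) \<Rightarrow> ('a \<Rightarrow> 'b) \<Rightarrow> bool"
  where
  "bounded_linear_on V N W M T \<longleftrightarrow>
     T \<in> V \<rightarrow> W \<and>
     (\<forall>x\<in>V. \<forall>y\<in>V. T (x + y) = T x + T y) \<and>
     (\<forall>a. \<forall>x\<in>V. T (a *\<^sub>R x) = a *\<^sub>R T x) \<and>
     (\<exists>C. \<forall>x\<in>V. M (T x) \<le> C * N x)"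

definition quotient_map_on ::
    "'a::real_vector set \<Rightarrow> ('a \<Rightarrow> real) \<Rightarrow> 'b::real_vector set \<Rightarrow> ('b \<Rightarrow> real) \<Rightarrow> ('a \<Rightarrow> 'b) \<Rightarrow> bool"
  where
  "quotient_map_on V N W M T \<longleftrightarrow> bounded_linear_on V N W M T \<and> T ` V = W"

definition isomorphic_spaces ::
    "'a::real_vector set \<Rightarrow> ('a \<Rightarrow> real) \<Rightarrow> 'b::real_vector set \<Rightarrow> ('b \<Rightarrow> real) \<Rightarrow> bool" where
  "isomorphic_spaces V N W M \<longleftrightarrow>
     (\<exists>T. bounded_linear_on V N W M T \<and> bij_betw T V W \<and>
          bounded_linear_on W M V N (inv_into V T))"

definition complemented_in :: "'a::real_vector set \<Rightarrow> 'a set \<Rightarrow> ('a \<Rightarrow> real) \<Rightarrow> bool" where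
  "complemented_in U V N \<longleftrightarrow>
     (\<exists>P. bounded_linear_on V N V N P \<and> (\<forall>x\<in>V. P (P x) = P x) \<and> P ` V = U)"

definition separable_subspace ::
    "real \<Rightarrow> 'a::real_vector set \<Rightarrow> 'a set \<Rightarrow> ('a \<Rightarrow> real) \<Rightarrow> bool" where
  "separable_subspace p U V N \<longleftrightarrow>
     subspace U \<and> U \<subseteq> V \<and> separable_space (subtopology (p_topology p V N) U)"

definition SCP :: "real \<Rightarrow> 'a::real_vector set \<Rightarrow> ('a \<Rightarrow> real) \<Rightarrow> bool" where
  "SCP p V N \<longleftrightarrow>
     (\<forall>U. separable_subspace p U V N \<longrightarrow>
       (\<exists>W. U \<subseteq> W \<and> separable_subspace p W V N \<and> complemented_in W V N))"

(* The cardinal is that of the index type 'i. *)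

definition lp_space :: "real \<Rightarrow> ('i \<Rightarrow> real) set" where
  "lp_space p = {x. (\<lambda>i. \<bar>x i\<bar> powr p) summable_on UNIV}"

definition lp_norm :: "real \<Rightarrow> ('i \<Rightarrow> real) \<Rightarrow> real" where
  "lp_norm p x = (\<Sum>\<^sub>\<infinity>i. \<bar>x i\<bar> powr p) powr (1 / p)"

definition kernel_on :: "'a set \<Rightarrow> ('a \<Rightarrow> 'b::zero) \<Rightarrow> 'a set" where
  "kernel_on V T = {x \<in> V. T x = 0}"

end

(* Write e_k for the unit vectors of l_p and K = 'i + 'x. Let S : l_p(K) \<rightarrow> X agree with Q on the
   first summand and send the unit vector at a point x of the second one to x whenever
   N x powr p \<le> 2. Then Y = ker S is the pullback of Q and of a second quotient map onto X.

   Q is open, so every S e_x lifts to a vector of l_p('i) of bounded norm. Replacing e_x by this lift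
   gives an operator on l_p(K) that leaves S unchanged and projects Y onto the copy of ker Q.

   For the separable complementation property, a separable subspace of Y is supported on a countable
   A. Choose X' separable in X, containing S(l_p(A)), with a projection P onto it, and enlarge A by the
   indices of a countable dense subset of X' to a countable B. By successive approximation S maps
   l_p(B) onto X', so P (S e_k) lifts to l_p(B) with control of the norm. Sending e_k to itself for k
   in B and to this lift otherwise defines a projection T of l_p(K) onto l_p(B) with S T = P S, and T
   therefore restricts to a projection of Y onto the separable space of elements of Y supported in B. *)

theory Submission
  imports Defs
begin

section \<open>$p$-normed spaces\<close>

text \<open>The second summand is there because \<open>ker Q\<close> alone resists the argument.
  When a countable index set is enlarged so that \<open>Q\<close> covers X', the unit vectors
  brought in by preimages under \<open>Q\<close> may have images outside X'. Then X' must grow as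
  well, and the limit of an increasing sequence of complemented subspaces need not be complemented.
  The additional unit vectors are mapped to prescribed points, so those mapped into X' can be added
  without disturbing X', and one projection P suffices.

  The bound 2 has room to spare: a vector u of X' with \<open>N u powr p = 1\<close> lies within 1/2
  of some d of the dense set, so \<open>N d powr p \<le> 3/2\<close>, and every such d is the image
  of a unit vector.

  Lifts can be chosen without regard to linearity or continuity: as p \<le> 1, any bounded family in
  a p-Banach space is the family of images of the unit vectors under an operator on l_p. Estimates
  are stated for \<open>N x powr p\<close>, the quantity that obeys the triangle inequality.\<close>

locale p_normed_space =
  fixes p :: real and V :: "'a::real_vector set" and N :: "'a \<Rightarrow> real"
  assumes p_pos: "0 < p" and p_normed: "p_normed p V N"
begin

lemma subspace: "subspace V"
  using p_normed by (simp add: p_normed_def)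

lemma closed_simps [simp, intro]:
  shows "0 \<in> V" and "x \<in> V \<Longrightarrow> y \<in> V \<Longrightarrow> x + y \<in> V" and "x \<in> V \<Longrightarrow> y \<in> V \<Longrightarrow> x - y \<in> V"
    and "x \<in> V \<Longrightarrow> a *\<^sub>R x \<in> V" and "(\<And>i. i \<in> A \<Longrightarrow> f i \<in> V) \<Longrightarrow> sum f A \<in> V"
  using subspace by (auto intro: subspace_0 subspace_add subspace_diff subspace_scale subspace_sum)

lemma nonneg: "x \<in> V \<Longrightarrow> 0 \<le> N x"
  using p_normed by (simp add: p_normed_def)

lemma powr_eq_0_iff: "x \<in> V \<Longrightarrow> N x powr p = 0 \<longleftrightarrow> x = 0"
  using p_normed by (simp add: p_normed_def)

lemma zero_powr [simp]: "N 0 powr p = 0"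
  using powr_eq_0_iff by blast

lemma scale_powr: "x \<in> V \<Longrightarrow> N (a *\<^sub>R x) powr p = \<bar>a\<bar> powr p * N x powr p"
  using p_normed by (simp add: p_normed_def powr_mult)

lemma minus_commute: "x \<in> V \<Longrightarrow> y \<in> V \<Longrightarrow> N (x - y) powr p = N (y - x) powr p"
  using scale_powr[of "x - y" "-1"] by simp

lemma triangle: "x \<in> V \<Longrightarrow> y \<in> V \<Longrightarrow> N (x + y) powr p \<le> N x powr p + N y powr p"
  using p_normed by (simp add: p_normed_def)

lemma diff_triangle:
  "x \<in> V \<Longrightarrow> y \<in> V \<Longrightarrow> z \<in> V \<Longrightarrow> N (x - z) powr p \<le> N (x - y) powr p + N (y - z) powr p"
  using triangle[of "x - y" "y - z"] by simp

lemma diff_le: "x \<in> V \<Longrightarrow> y \<in> V \<Longrightarrow> N (x - y) powr p \<le> N x powr p + N y powr p"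
  using diff_triangle[of x 0 y] minus_commute[of 0 y] by simp

lemma le_diff: "x \<in> V \<Longrightarrow> y \<in> V \<Longrightarrow> N x powr p \<le> N (x - y) powr p + N y powr p"
  using triangle[of "x - y" y] by simp

lemma sum_le: "(\<And>i. i \<in> A \<Longrightarrow> f i \<in> V) \<Longrightarrow> N (sum f A) powr p \<le> (\<Sum>i\<in>A. N (f i) powr p)"
proof (induction A rule: infinite_finite_induct)
  case (insert a A)
  then show ?case
    using triangle[of "f a" "sum f A"] by fastforce
qed auto

lemma eq_if_small:
  assumes "x \<in> V" "y \<in> V" "\<And>e. 0 < e \<Longrightarrow> N (x - y) powr p \<le> e"
  shows "x = y"
proof -
  have "N (x - y) powr p \<le> 0"
    using assms(3) by (metis dense not_le)
  then have "N (x - y) powr p = 0"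
    by (simp add: order_antisym)
  then show ?thesis
    using powr_eq_0_iff[of "x - y"] assms by simp
qed

sublocale metric: Metric_space V "pdist p V N"
  using p_normed by (rule p_normed_Metric_space)

lemma pdist_eq: "x \<in> V \<Longrightarrow> y \<in> V \<Longrightarrow> pdist p V N x y = N (x - y) powr p"
  by (simp add: pdist_def)

text \<open>Removes the metric, with its default value off \<open>V\<close>, from every later
  completeness argument except the one by Baire category.\<close>

lemma p_banach_iff:
  "p_banach p V N \<longleftrightarrow>
    (\<forall>\<sigma>. range \<sigma> \<subseteq> V \<and> (\<forall>e>0. \<exists>n0. \<forall>m\<ge>n0. \<forall>n\<ge>n0. N (\<sigma> m - \<sigma> n) powr p < e)
      \<longrightarrow> (\<exists>x\<in>V. (\<lambda>n. N (\<sigma> n - x) powr p) \<longlonglongrightarrow> 0))"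
proof -
  have "metric.MCauchy \<sigma> \<longleftrightarrow>
      range \<sigma> \<subseteq> V \<and> (\<forall>e>0. \<exists>n0. \<forall>m\<ge>n0. \<forall>n\<ge>n0. N (\<sigma> m - \<sigma> n) powr p < e)" for \<sigma>
    unfolding metric.MCauchy_def by (rule conj_cong[OF refl]) (simp add: pdist_def range_subsetD)
  moreover have "limitin metric.mtopology \<sigma> x sequentially \<longleftrightarrow> x \<in> V \<and> (\<lambda>n. N (\<sigma> n - x) powr p) \<longlonglongrightarrow> 0"
    if "range \<sigma> \<subseteq> V" for \<sigma> x
    unfolding metric.limitin_metric_dist_null
    using that by (auto simp: pdist_def range_subsetD)
  ultimately show ?thesis
    unfolding p_banach_def metric.mcomplete_def using p_normed
    by (simp cong: conj_cong) (intro iff_allI imp_cong refl, auto)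
qed

text \<open>Countable approximation from the ambient space is enough because separability of metric
  spaces passes to subsets: for each d and n one point of \<open>U\<close> within 1/(n+1) of d is
  kept, if there is one. The second statement provides a dense set inside \<open>U\<close>, which
  survives a change of the ambient space.\<close>

lemma separable_subspace_iff:
  "separable_subspace p U V N \<longleftrightarrow> subspace U \<and> U \<subseteq> V \<and>
    (\<exists>D. countable D \<and> D \<subseteq> V \<and> (\<forall>x\<in>U. \<forall>e>0. \<exists>d\<in>D. N (x - d) powr p < e))"
    (is "_ \<longleftrightarrow> _ \<and> _ \<and> ?R")
  and separable_subspace_dense:
  "separable_subspace p U V N \<Longrightarrow> \<exists>D. countable D \<and> D \<subseteq> U \<and> (\<forall>x\<in>U. \<forall>e>0. \<exists>d\<in>D. N (x - d) powr p < e)"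
proof -
  let ?S = "\<exists>D. countable D \<and> D \<subseteq> U \<and> (\<forall>x\<in>U. \<forall>e>0. \<exists>d\<in>D. N (x - d) powr p < e)"
  have sep: "separable_space (subtopology (p_topology p V N) U) \<longleftrightarrow> ?S" if "U \<subseteq> V"
  proof -
    have *: "(subtopology metric.mtopology U) closure_of D = {x\<in>U. \<forall>e>0. \<exists>d\<in>D. N (x - d) powr p < e}"
      if "D \<subseteq> U" for D
    proof -
      have "D \<subseteq> V" and "U \<inter> D = D"
        using that \<open>U \<subseteq> V\<close> by auto
      then show ?thesis
        using \<open>U \<subseteq> V\<close> by (fastforce simp: closure_of_subtopology metric.metric_closure_of pdist_def subset_iff)
    qed
    have **: "(subtopology metric.mtopology U) closure_of D = U \<longleftrightarrow> (\<forall>x\<in>U. \<forall>e>0. \<exists>d\<in>D. N (x - d) powr p < e)"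
      if "D \<subseteq> U" for D
    proof -
      have "{x\<in>U. P x} = U \<longleftrightarrow> (\<forall>x\<in>U. P x)" for P
        by blast
      then show ?thesis
        unfolding *[OF that] .
    qed
    have "topspace (subtopology metric.mtopology U) = U"
      using that by auto
    then show ?thesis
      unfolding separable_space_def p_topology_def
      by (intro ex_cong1 conj_cong refl) (simp_all add: ** del: closure_of_eq)
  qed
  have "?S" if "?R" "U \<subseteq> V"
  proof -
    from \<open>?R\<close> obtain D where D: "countable D" "D \<subseteq> V" "\<And>x e. x \<in> U \<Longrightarrow> 0 < e \<Longrightarrow> \<exists>d\<in>D. N (x - d) powr p < e"
      by blast
    define near where "near d n u \<longleftrightarrow> u \<in> U \<and> N (u - d) powr p < inverse (Suc n)" for d u and n :: nat
    define E where "E = {SOME u. near d n u | d n. d \<in> D \<and> (\<exists>u. near d n u)}"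
    have E_near: "near d n (SOME u. near d n u)" if "near d n u" for d n u
      using that by (rule someI)
    have "E \<subseteq> (\<lambda>(d, n). SOME u. near d n u) ` (D \<times> UNIV)"
      unfolding E_def by auto
    then have "countable E"
      using D(1) by (meson countable_SIGMA countable_image countable_subset countableI_type)
    moreover have "E \<subseteq> U"
      unfolding E_def using E_near near_def by blast
    moreover have "\<exists>d\<in>E. N (x - d) powr p < e" if x: "x \<in> U" and "0 < e" for x e
    proof -
      obtain n where n: "inverse (real (Suc n)) < e / 2"
        using reals_Archimedean[of "e / 2"] \<open>0 < e\<close> by auto
      obtain d where d: "d \<in> D" "N (x - d) powr p < inverse (Suc n)"
        using D(3)[OF x, of "inverse (Suc n)"] by auto
      define u where "u = (SOME u. near d n u)"
      have "near d n x"
        using x d by (simp add: near_def)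
      then have u: "near d n u" "u \<in> E"
        unfolding u_def E_def using E_near d by blast+
      have "N (x - u) powr p \<le> N (x - d) powr p + N (d - u) powr p"
        using x u d D(2) \<open>U \<subseteq> V\<close> by (intro diff_triangle) (auto simp: near_def)
      also have "N (d - u) powr p = N (u - d) powr p"
        using x u d D(2) \<open>U \<subseteq> V\<close> by (intro minus_commute) (auto simp: near_def)
      finally show ?thesis
        using u d n by (intro bexI[of _ u]) (auto simp: near_def)
    qed
    ultimately show ?thesis by blast
  qed
  then have "?S \<longleftrightarrow> ?R" if "U \<subseteq> V"
    using that by (intro iffI) (elim exE, metis subset_trans)
  with sep show "separable_subspace p U V N \<longleftrightarrow> subspace U \<and> U \<subseteq> V \<and> ?R"
    unfolding separable_subspace_def by (intro conj_cong refl) (simp only:)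
  from sep show "separable_subspace p U V N \<Longrightarrow> ?S"
    unfolding separable_subspace_def by (simp only:)
qed

end

section \<open>Limits of Cauchy sequences in complete spaces\<close>

context p_normed_space
begin

lemma Cauchy_limit:
  assumes "p_banach p V N" "\<And>n. \<sigma> n \<in> V"
    and "\<And>e. 0 < e \<Longrightarrow> \<exists>n0. \<forall>m\<ge>n0. \<forall>n\<ge>n0. N (\<sigma> m - \<sigma> n) powr p < e"
  obtains x where "x \<in> V" "(\<lambda>n. N (\<sigma> n - x) powr p) \<longlonglongrightarrow> 0"
proof -
  have "range \<sigma> \<subseteq> V \<and> (\<forall>e>0. \<exists>n0. \<forall>m\<ge>n0. \<forall>n\<ge>n0. N (\<sigma> m - \<sigma> n) powr p < e)"
    using assms(2,3) by (intro conjI image_subsetI allI impI)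
  then have "\<exists>x\<in>V. (\<lambda>n. N (\<sigma> n - x) powr p) \<longlonglongrightarrow> 0"
    by (rule assms(1)[unfolded p_banach_iff, THEN spec, THEN mp])
  then show thesis
    using that by (elim bexE)
qed

text \<open>The explicit rate is the point: at n = 0 it bounds the distance from the start of the
  sequence to the limit, which is how lifts acquire norm bounds. The factor 2 is the sum of the
  geometric series.\<close>

lemma geometric_limit:
  assumes complete: "p_banach p V N" and \<sigma>: "\<And>n. \<sigma> n \<in> V"
    and step: "\<And>n. N (\<sigma> (Suc n) - \<sigma> n) powr p \<le> c * (1/2)^n"
  obtains x where "x \<in> V" "\<And>n. N (x - \<sigma> n) powr p \<le> 2 * c * (1/2)^n"
proof -
  have c: "0 \<le> c"
    using step[of 0] powr_ge_zero[of "N (\<sigma> (Suc 0) - \<sigma> 0)" p] by (simp del: powr_ge_zero)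
  \<comment> \<open>The factor \<open>1 - (1/2)^k\<close> makes the bound an exact partial sum of
    the geometric series, so that the induction closes.\<close>
  have "N (\<sigma> (n + k) - \<sigma> n) powr p \<le> 2 * c * (1/2)^n * (1 - (1/2)^k)" for n k
  proof (induction k)
    case (Suc k)
    have "N (\<sigma> (n + Suc k) - \<sigma> n) powr p \<le> N (\<sigma> (Suc (n + k)) - \<sigma> (n + k)) powr p + N (\<sigma> (n + k) - \<sigma> n) powr p"
      using diff_triangle[OF \<sigma> \<sigma> \<sigma>, of "Suc (n + k)" n "n + k"] by simp
    also have "\<dots> \<le> c * (1/2)^(n + k) + 2 * c * (1/2)^n * (1 - (1/2)^k)"
      using step Suc.IH by (rule add_mono)
    also have "\<dots> = 2 * c * (1/2)^n * (1 - (1/2)^Suc k)"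
      by (simp add: algebra_simps power_add)
    finally show ?case .
  qed simp
  moreover have "2 * c * (1/2)^n * (1 - (1/2)^k) \<le> 2 * c * (1/2)^n" for n k :: nat
    using c by (intro mult_right_le_one_le) (auto simp: power_le_one)
  ultimately have tail: "N (\<sigma> m - \<sigma> n) powr p \<le> 2 * c * (1/2)^n" if "n \<le> m" for m n
    using that le_Suc_ex[OF that] by (metis order_trans)
  have "\<exists>n0. \<forall>m\<ge>n0. \<forall>n\<ge>n0. N (\<sigma> m - \<sigma> n) powr p < e" if "0 < e" for e
  proof -
    have "(\<lambda>n. 4 * c * (1/2::real)^n) \<longlonglongrightarrow> 4 * c * 0"
      by (intro tendsto_intros) auto
    then have "\<forall>\<^sub>F n in sequentially. 4 * c * (1/2::real)^n < e"
      using \<open>0 < e\<close> by (intro order_tendstoD(2)) auto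
    then obtain n0 where n0: "4 * c * (1/2::real)^n0 < e"
      using eventually_happens'[OF sequentially_bot] by blast
    have "N (\<sigma> m - \<sigma> n) powr p < e" if "m \<ge> n0" "n \<ge> n0" for m n
      using diff_triangle[OF \<sigma> \<sigma> \<sigma>, of m n n0] minus_commute[OF \<sigma> \<sigma>, of n0 n]
        tail[OF that(1)] tail[OF that(2)] n0 by simp
    then show ?thesis by blast
  qed
  then obtain x where x: "x \<in> V" "(\<lambda>n. N (\<sigma> n - x) powr p) \<longlonglongrightarrow> 0"
    by (rule Cauchy_limit[OF complete \<sigma>]) (assumption, rule that)
  have "N (x - \<sigma> n) powr p \<le> 2 * c * (1/2)^n" for n
  proof (rule tendsto_lowerbound)
    show "(\<lambda>m. N (\<sigma> m - x) powr p + 2 * c * (1/2)^n) \<longlonglongrightarrow> 2 * c * (1/2)^n"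
      using tendsto_add[OF x(2) tendsto_const] by simp
    show "\<forall>\<^sub>F m in sequentially. N (x - \<sigma> n) powr p \<le> N (\<sigma> m - x) powr p + 2 * c * (1/2)^n"
      using eventually_ge_at_top[of n]
    proof eventually_elim
      case (elim m)
      then show ?case
        using diff_triangle[OF x(1) \<sigma> \<sigma>, of n m] minus_commute[OF x(1) \<sigma>, of m] tail[of n m] by simp
    qed
  qed auto
  with x(1) that show thesis by blast
qed

end

section \<open>Bounded linear maps\<close>

definition linear_map_on :: "'a::real_vector set \<Rightarrow> 'b::real_vector set \<Rightarrow> ('a \<Rightarrow> 'b) \<Rightarrow> bool" where
  "linear_map_on V W T \<longleftrightarrow>
    T \<in> V \<rightarrow> W \<and> (\<forall>x\<in>V. \<forall>y\<in>V. T (x + y) = T x + T y) \<and> (\<forall>a. \<forall>x\<in>V. T (a *\<^sub>R x) = a *\<^sub>R T x)"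

locale p_normed_pair = dom: p_normed_space p V N + cod: p_normed_space p W M
  for p :: real and V :: "'a::real_vector set" and N and W :: "'b::real_vector set" and M
begin

text \<open>Bounds on p-th powers can be added along sums. The constant in the definition may be
  negative, so its absolute value is taken before raising to the power p.\<close>

lemma bounded_linear_on_iff:
  "bounded_linear_on V N W M T \<longleftrightarrow>
    linear_map_on V W T \<and> (\<exists>C\<ge>0. \<forall>x\<in>V. M (T x) powr p \<le> C * N x powr p)"
proof -
  have "(\<exists>C. \<forall>x\<in>V. M (T x) \<le> C * N x) \<longleftrightarrow> (\<exists>C\<ge>0. \<forall>x\<in>V. M (T x) powr p \<le> C * N x powr p)"
    if "T \<in> V \<rightarrow> W"
  proof
    assume "\<exists>C. \<forall>x\<in>V. M (T x) \<le> C * N x"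
    then obtain C where C: "\<forall>x\<in>V. M (T x) \<le> C * N x" ..
    have "M (T x) powr p \<le> \<bar>C\<bar> powr p * N x powr p" if "x \<in> V" for x
    proof -
      have "M (T x) \<le> \<bar>C\<bar> * N x"
        using C that dom.nonneg[OF that] by (metis abs_ge_self mult_right_mono order_trans)
      then have "M (T x) powr p \<le> (\<bar>C\<bar> * N x) powr p"
        using cod.nonneg \<open>T \<in> V \<rightarrow> W\<close> that dom.p_pos by (intro powr_mono2) auto
      then show ?thesis
        using dom.nonneg[OF that] by (simp add: powr_mult)
    qed
    then show "\<exists>C\<ge>0. \<forall>x\<in>V. M (T x) powr p \<le> C * N x powr p"
      by (intro exI[of _ "\<bar>C\<bar> powr p"]) auto
  next
    assume "\<exists>C\<ge>0. \<forall>x\<in>V. M (T x) powr p \<le> C * N x powr p"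
    then obtain C where C: "0 \<le> C" "\<forall>x\<in>V. M (T x) powr p \<le> C * N x powr p" by blast
    have "M (T x) \<le> C powr (1/p) * N x" if "x \<in> V" for x
    proof -
      have "(M (T x) powr p) powr (1/p) \<le> (C * N x powr p) powr (1/p)"
        using C that dom.p_pos by (intro powr_mono2) auto
      then show ?thesis
        using C dom.nonneg[OF that] cod.nonneg[of "T x"] \<open>T \<in> V \<rightarrow> W\<close> that dom.p_pos
        by (simp add: powr_mult powr_powr Pi_iff)
    qed
    then show "\<exists>C. \<forall>x\<in>V. M (T x) \<le> C * N x" by blast
  qed
  then show ?thesis
    unfolding bounded_linear_on_def linear_map_on_def by blast
qed

lemma bounded_linear_onE:
  assumes "bounded_linear_on V N W M T"
  obtains C where "0 \<le> C" "\<And>x. x \<in> V \<Longrightarrow> M (T x) powr p \<le> C * N x powr p"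
  using assms that by (auto simp: bounded_linear_on_iff)

lemma bounded_linear_onI:
  assumes "linear_map_on V W T" "\<And>x. x \<in> V \<Longrightarrow> M (T x) powr p \<le> C * N x powr p" "0 \<le> C"
  shows "bounded_linear_on V N W M T"
  unfolding bounded_linear_on_iff using assms by (intro conjI exI[of _ C] ballI)

end

lemma linear_map_onD:
  assumes "linear_map_on V W T"
  shows linear_map_on_mem: "x \<in> V \<Longrightarrow> T x \<in> W"
    and linear_map_on_add: "x \<in> V \<Longrightarrow> y \<in> V \<Longrightarrow> T (x + y) = T x + T y"
    and linear_map_on_scale: "x \<in> V \<Longrightarrow> T (a *\<^sub>R x) = a *\<^sub>R T x"
  using assms by (auto simp: linear_map_on_def)

lemma linear_map_on_diff:
  assumes "linear_map_on V W T" "subspace V" "x \<in> V" "y \<in> V"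
  shows "T (x - y) = T x - T y"
  using linear_map_on_add[OF assms(1), of x "-1 *\<^sub>R y"] linear_map_on_scale[OF assms(1), of y "-1"]
    subspace_neg[OF assms(2)] assms(3,4) by simp

lemma linear_map_on_0:
  assumes "linear_map_on V W T" "subspace V"
  shows "T 0 = 0"
  using linear_map_on_diff[OF assms, of 0 0] subspace_0[OF assms(2)] by simp

lemma linear_map_on_sum:
  assumes "linear_map_on V W T" "subspace V" "\<And>i. i \<in> A \<Longrightarrow> f i \<in> V"
  shows "T (sum f A) = (\<Sum>i\<in>A. T (f i))"
  using assms(3)
proof (induction A rule: infinite_finite_induct)
  case (insert a A)
  then show ?case
    using linear_map_on_add[OF assms(1), of "f a" "sum f A"] subspace_sum[OF assms(2), of A f] by simp
qed (auto simp: linear_map_on_0[OF assms(1,2)])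

lemma linear_map_on_comp:
  "linear_map_on U V S \<Longrightarrow> linear_map_on V W T \<Longrightarrow> linear_map_on U W (\<lambda>x. T (S x))"
  by (auto simp: linear_map_on_def Pi_iff)

lemma bounded_linear_on_imp_linear: "bounded_linear_on V N W M T \<Longrightarrow> linear_map_on V W T"
  by (simp add: bounded_linear_on_def linear_map_on_def)

lemma bounded_linear_on_comp:
  assumes "p_normed_space p U L" "p_normed_space p V N" "p_normed_space p W M"
    and S: "bounded_linear_on U L V N S" and T: "bounded_linear_on V N W M T"
  shows "bounded_linear_on U L W M (\<lambda>x. T (S x))"
proof -
  interpret UV: p_normed_pair p U L V N
    using assms by (simp add: p_normed_pair_def)
  interpret VW: p_normed_pair p V N W M
    using assms by (simp add: p_normed_pair_def)
  interpret UW: p_normed_pair p U L W M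
    using assms by (simp add: p_normed_pair_def)
  obtain C where C: "0 \<le> C" "\<And>x. x \<in> U \<Longrightarrow> N (S x) powr p \<le> C * L x powr p"
    by (rule UV.bounded_linear_onE[OF S]) (rule that)
  obtain D where D: "0 \<le> D" "\<And>x. x \<in> V \<Longrightarrow> M (T x) powr p \<le> D * N x powr p"
    by (rule VW.bounded_linear_onE[OF T]) (rule that)
  show ?thesis
  proof (rule UW.bounded_linear_onI)
    show "linear_map_on U W (\<lambda>x. T (S x))"
      by (rule linear_map_on_comp[OF bounded_linear_on_imp_linear[OF S] bounded_linear_on_imp_linear[OF T]])
    show "M (T (S x)) powr p \<le> D * C * L x powr p" if "x \<in> U" for x
    proof -
      have "S x \<in> V"
        using bounded_linear_on_imp_linear[OF S] that by (rule linear_map_on_mem)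
      then have "M (T (S x)) powr p \<le> D * N (S x) powr p"
        by (rule D(2))
      also have "\<dots> \<le> D * (C * L x powr p)"
        using C(2)[OF that] D(1) by (rule mult_left_mono)
      finally show ?thesis by simp
    qed
  qed (use C D in simp)
qed

context p_normed_space
begin

lemma p_normed_subspace: "subspace U \<Longrightarrow> U \<subseteq> V \<Longrightarrow> p_normed p U N"
  using p_normed by (auto simp: p_normed_def subset_iff)

end

section \<open>Kernels, successive approximation and the open mapping theorem\<close>

context p_normed_pair
begin

text \<open>A limit x of kernel elements \<open>\<sigma> n\<close> stays in the kernel, since
  \<open>M (T x) powr p\<close> is at most C times \<open>N (\<sigma> n - x) powr p\<close>. This
  later gives the completeness of the pullback.\<close>

lemma p_banach_kernel:
  assumes complete: "p_banach p V N" and T: "bounded_linear_on V N W M T"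
  shows "p_banach p (kernel_on V T) N"
proof -
  note lin = bounded_linear_on_imp_linear[OF T]
  let ?K = "kernel_on V T"
  have K: "subspace ?K"
    using linear_map_on_0[OF lin dom.subspace] linear_map_onD[OF lin]
    by (auto simp: subspace_def kernel_on_def)
  have "?K \<subseteq> V"
    by (auto simp: kernel_on_def)
  then interpret K: p_normed_space p ?K N
    using dom.p_pos dom.p_normed_subspace[OF K] by (intro p_normed_space.intro)
  show ?thesis
    unfolding K.p_banach_iff
  proof (intro allI impI, elim conjE)
    fix \<sigma> :: "nat \<Rightarrow> 'a" assume \<sigma>: "range \<sigma> \<subseteq> ?K"
      "\<forall>e>0. \<exists>n0. \<forall>m\<ge>n0. \<forall>n\<ge>n0. N (\<sigma> m - \<sigma> n) powr p < e"
    then have \<sigma>V: "\<sigma> n \<in> V" for n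
      by (auto simp: kernel_on_def)
    obtain x where x: "x \<in> V" "(\<lambda>n. N (\<sigma> n - x) powr p) \<longlonglongrightarrow> 0"
      by (rule dom.Cauchy_limit[OF complete \<sigma>V \<sigma>(2)[rule_format]]) (assumption, rule that)
    obtain C where C: "0 \<le> C" "\<And>x. x \<in> V \<Longrightarrow> M (T x) powr p \<le> C * N x powr p"
      by (rule bounded_linear_onE[OF T]) (rule that)
    have "M (T x) powr p \<le> C * N (\<sigma> n - x) powr p" for n
    proof -
      have \<sigma>n: "\<sigma> n \<in> V" "T (\<sigma> n) = 0"
        using \<sigma> by (auto simp: kernel_on_def)
      have "M (T (x - \<sigma> n)) powr p \<le> C * N (x - \<sigma> n) powr p"
        using x \<sigma>n by (intro C) auto
      then show ?thesis
        using x \<sigma>n by (simp add: linear_map_on_diff[OF lin dom.subspace] dom.minus_commute)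
    qed
    moreover have "(\<lambda>n. C * N (\<sigma> n - x) powr p) \<longlonglongrightarrow> C * 0"
      using x(2) by (rule tendsto_mult_left)
    ultimately have "M (T x) powr p \<le> C * 0"
      by (intro LIMSEQ_le_const) auto
    then have "M (T x) powr p = 0"
      by (simp add: order_antisym)
    then have "T x = 0"
      using cod.powr_eq_0_iff linear_map_on_mem[OF lin x(1)] by blast
    with x show "\<exists>x\<in>?K. (\<lambda>n. N (\<sigma> n - x) powr p) \<longlonglongrightarrow> 0"
      by (auto simp: kernel_on_def)
  qed
qed

text \<open>Each residue is at most half the previous one, so the corrections form a geometric
  series and the constant only doubles. \<open>W'\<close> is a set in which the residues stay: all
  of \<open>W\<close> for the open mapping theorem, a separable complemented subspace for the
  SCP.\<close>

lemma lift_of_approximate_lift: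
  assumes complete: "p_banach p V N" and T: "bounded_linear_on V N W M T"
    and sub: "W' \<subseteq> W" and C: "0 \<le> C"
    and approx: "\<And>x. x \<in> W' \<Longrightarrow> \<exists>y\<in>V. N y powr p \<le> C * M x powr p \<and> x - T y \<in> W' \<and>
      M (x - T y) powr p \<le> M x powr p / 2"
    and w: "w \<in> W'"
  shows "\<exists>y\<in>V. T y = w \<and> N y powr p \<le> 2 * C * M w powr p"
proof -
  note lin = bounded_linear_on_imp_linear[OF T]
  obtain g where g: "\<And>x. x \<in> W' \<Longrightarrow> g x \<in> V \<and> N (g x) powr p \<le> C * M x powr p \<and> x - T (g x) \<in> W' \<and>
      M (x - T (g x)) powr p \<le> M x powr p / 2"
    using approx by metis
  \<comment> \<open>\<open>r n\<close> is what remains of w after n corrections, and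
    \<open>s n\<close> below is their sum.\<close>
  define r where "r n = ((\<lambda>x. x - T (g x)) ^^ n) w" for n
  have r_0: "r 0 = w" and r_Suc: "r (Suc n) = r n - T (g (r n))" for n
    by (simp_all add: r_def)
  have r: "r n \<in> W' \<and> M (r n) powr p \<le> M w powr p * (1/2)^n" for n
  proof (induction n)
    case (Suc n)
    then show ?case
      using g[of "r n"] unfolding r_Suc by auto
  qed (use w in \<open>simp add: r_0\<close>)
  define s where "s n = (\<Sum>i<n. g (r i))" for n
  have s: "s n \<in> V" for n
    unfolding s_def using g r by auto
  have Ts: "T (s n) = w - r n" for n
  proof (induction n)
    case (Suc n)
    have "T (s (Suc n)) = T (s n) + T (g (r n))"
      using s g r unfolding s_def by (simp flip: linear_map_on_add[OF lin])
    then show ?case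
      using Suc by (simp add: r_Suc)
  qed (simp add: s_def r_0 linear_map_on_0[OF lin dom.subspace])
  have step: "N (s (Suc n) - s n) powr p \<le> C * M w powr p * (1/2)^n" for n
  proof -
    have "N (g (r n)) powr p \<le> C * M (r n) powr p"
      using g r by blast
    also have "\<dots> \<le> C * (M w powr p * (1/2)^n)"
      using r C by (blast intro: mult_left_mono)
    finally show ?thesis
      by (simp add: s_def mult_ac)
  qed
  obtain y where y: "y \<in> V" "\<And>n. N (y - s n) powr p \<le> 2 * (C * M w powr p) * (1/2)^n"
    by (rule dom.geometric_limit[OF complete s step]) (rule that)
  obtain D where D: "0 \<le> D" "\<And>x. x \<in> V \<Longrightarrow> M (T x) powr p \<le> D * N x powr p"
    by (rule bounded_linear_onE[OF T]) (rule that)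
  \<comment> \<open>Since \<open>T (s n) = w - r n\<close>, the vector \<open>T y - w\<close> splits
    into \<open>T y - T (s n)\<close> and \<open>- r n\<close>, and both decay like (1/2)^n.\<close>
  have "M (T y - w) powr p \<le> (D * (2 * (C * M w powr p)) + M w powr p) * (1/2)^n" for n
  proof -
    have rn: "r n \<in> W" "w \<in> W" "T y \<in> W" "T (s n) \<in> W"
      using r w sub y s by (auto intro: linear_map_on_mem[OF lin])
    have "M (T y - w) powr p = M ((T y - T (s n)) - r n) powr p"
      by (simp add: Ts)
    also have "\<dots> \<le> M (T y - T (s n)) powr p + M (r n) powr p"
      using rn by (intro cod.diff_le cod.closed_simps)
    also have "M (T y - T (s n)) powr p \<le> D * N (y - s n) powr p"
      using y s D by (simp flip: linear_map_on_diff[OF lin dom.subspace])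
    also have "D * N (y - s n) powr p \<le> D * (2 * (C * M w powr p) * (1/2)^n)"
      using y(2) D(1) by (rule mult_left_mono)
    finally show ?thesis
      using r[of n] by (simp add: algebra_simps)
  qed
  moreover have "(\<lambda>n. (D * (2 * (C * M w powr p)) + M w powr p) * (1/2::real)^n) \<longlonglongrightarrow>
      (D * (2 * (C * M w powr p)) + M w powr p) * 0"
    by (intro tendsto_intros) auto
  ultimately have "M (T y - w) powr p \<le> (D * (2 * (C * M w powr p)) + M w powr p) * 0"
    by (intro LIMSEQ_le_const) auto
  then have "M (T y - w) powr p \<le> 0"
    by simp
  then have "T y = w"
    using y w sub linear_map_on_mem[OF lin y(1)] by (intro cod.eq_if_small) auto
  moreover have "N y powr p \<le> 2 * C * M w powr p"
    using y(2)[of 0] by (simp add: s_def)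
  ultimately show ?thesis
    using y(1) by blast
qed

text \<open>Baire category only yields approximation of the points of some ball by images of a
  bounded set; \<open>lift_of_approximate_lift\<close> turns this into exact lifts.\<close>

lemma open_mapping:
  assumes V: "p_banach p V N" and W: "p_banach p W M" and Q: "quotient_map_on V N W M T"
  shows "\<exists>C\<ge>0. \<forall>w\<in>W. \<exists>y\<in>V. T y = w \<and> N y powr p \<le> C * M w powr p"
proof -
  have T: "bounded_linear_on V N W M T" and surj: "T ` V = W"
    using Q by (auto simp: quotient_map_on_def)
  note lin = bounded_linear_on_imp_linear[OF T]
  define B where "B n = T ` {y \<in> V. N y powr p \<le> real n}" for n :: nat
  have B_sub: "B n \<subseteq> W" for n
    using surj by (auto simp: B_def)
  have "\<Union>(range (\<lambda>n. cod.metric.mtopology closure_of B n)) = W"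
  proof
    show "\<Union>(range (\<lambda>n. cod.metric.mtopology closure_of B n)) \<subseteq> W"
      using closure_of_subset_topspace by fastforce
    show "W \<subseteq> \<Union>(range (\<lambda>n. cod.metric.mtopology closure_of B n))"
    proof
      fix w assume "w \<in> W"
      then obtain y where y: "y \<in> V" "T y = w"
        using surj by blast
      obtain n :: nat where "N y powr p \<le> real n"
        using real_arch_simple by blast
      then have "w \<in> B n"
        using y by (auto simp: B_def)
      moreover have "B n \<subseteq> cod.metric.mtopology closure_of B n"
        using B_sub by (intro closure_of_subset) simp
      ultimately show "w \<in> \<Union>(range (\<lambda>n. cod.metric.mtopology closure_of B n))"
        by blast
    qed
  qed
  moreover have "cod.metric.mtopology interior_of W = W"
    using interior_of_topspace[of cod.metric.mtopology] by simp
  moreover have "0 \<in> W"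
    by simp
  ultimately have nonempty: "cod.metric.mtopology interior_of \<Union>(range (\<lambda>n. cod.metric.mtopology closure_of B n)) \<noteq> {}"
    by auto
  have "\<exists>n. cod.metric.mtopology interior_of (cod.metric.mtopology closure_of B n) \<noteq> {}"
  proof (rule ccontr)
    assume "\<not> ?thesis"
    then have "cod.metric.mtopology interior_of \<Union>(range (\<lambda>n. cod.metric.mtopology closure_of B n)) = {}"
      using W unfolding p_banach_def by (intro cod.metric.metric_Baire_category_alt) auto
    with nonempty show False
      by contradiction
  qed
  then obtain n where "cod.metric.mtopology interior_of (cod.metric.mtopology closure_of B n) \<noteq> {}"
    by blast
  then obtain w e where w: "w \<in> W" and e: "0 < e" and
    ball: "cod.metric.mball w e \<subseteq> cod.metric.mtopology closure_of B n"
    unfolding cod.metric.metric_interior_of by blast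
  have approx: "\<exists>y\<in>V. N y powr p \<le> real n \<and> M (w' - T y) powr p < d"
    if "w' \<in> W" "M (w - w') powr p < e" "0 < d" for w' d
  proof -
    have "w' \<in> cod.metric.mtopology closure_of B n"
      using ball that w by (auto simp: cod.pdist_eq)
    then show ?thesis
      using \<open>0 < d\<close> unfolding cod.metric.metric_closure_of B_def by (fastforce simp: cod.pdist_eq)
  qed
  have "\<exists>y\<in>V. T y = z \<and> N y powr p \<le> 2 * (4 * real n / e) * M z powr p" if "z \<in> W" for z
  proof (rule lift_of_approximate_lift[OF V T subset_refl _ _ that])
    fix z assume z: "z \<in> W"
    show "\<exists>y\<in>V. N y powr p \<le> 4 * real n / e * M z powr p \<and> z - T y \<in> W \<and> M (z - T y) powr p \<le> M z powr p / 2"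
    proof (cases "z = 0")
      case True
      then show ?thesis
        by (intro bexI[of _ 0]) (auto simp: linear_map_on_0[OF lin dom.subspace])
    next
      case False
      define F where "F = M z powr p"
      have F: "0 < F"
        unfolding F_def using cod.powr_eq_0_iff[OF z] False by (metis less_eq_real_def powr_ge_zero)
      \<comment> \<open>The factor a gives \<open>a *\<^sub>R z\<close> the p-th power e/2, which
        keeps \<open>w + a *\<^sub>R z\<close> inside the ball around w. Subtracting approximate
        lifts of the two points and scaling by 1/a multiplies p-th powers by 2F/e; the tolerance e/8
        then leaves the required error F/2.\<close>
      define a where "a = (e / (2 * F)) powr (1 / p)"
      have ap: "a powr p = e / (2 * F)"
        using e F dom.p_pos by (simp add: a_def powr_powr)
      have a: "0 < a"
        using e F by (simp add: a_def)
      have az: "M (a *\<^sub>R z) powr p = e / 2"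
        using F a by (simp add: cod.scale_powr[OF z] ap flip: F_def)
      have "M (w - (w + a *\<^sub>R z)) powr p = e / 2"
        using az cod.scale_powr[of "a *\<^sub>R z" "-1"] z by simp
      then obtain y1 where y1: "y1 \<in> V" "N y1 powr p \<le> real n" "M (w + a *\<^sub>R z - T y1) powr p < e / 8"
        using approx[of "w + a *\<^sub>R z" "e / 8"] e w z by auto
      obtain y2 where y2: "y2 \<in> V" "N y2 powr p \<le> real n" "M (w - T y2) powr p < e / 8"
        using approx[of w "e / 8"] e w by auto
      define y where "y = (1 / a) *\<^sub>R (y1 - y2)"
      have ap': "(1 / a) powr p = 2 * F / e"
        using a by (simp add: powr_divide ap)
      have y: "y \<in> V"
        using y1 y2 by (simp add: y_def)
      have "N y powr p = 2 * F / e * N (y1 - y2) powr p"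
        using y1 y2 a ap' by (simp add: y_def dom.scale_powr)
      also have "\<dots> \<le> 2 * F / e * (real n + real n)"
        using dom.diff_le[OF y1(1) y2(1)] y1 y2 e F by (intro mult_left_mono) auto
      finally have Ny: "N y powr p \<le> 4 * real n / e * M z powr p"
        by (simp add: F_def mult_ac)
      have T12: "T y1 \<in> W" "T y2 \<in> W"
        using y1 y2 linear_map_on_mem[OF lin] by auto
      have "z - T y = (1 / a) *\<^sub>R ((w + a *\<^sub>R z - T y1) - (w - T y2))"
        using y1 y2 a unfolding y_def
        by (simp add: linear_map_on_scale[OF lin] linear_map_on_diff[OF lin dom.subspace] algebra_simps)
      then have "M (z - T y) powr p = 2 * F / e * M ((w + a *\<^sub>R z - T y1) - (w - T y2)) powr p"
        using a ap' w z T12 by (simp only: cod.scale_powr cod.closed_simps) simp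
      also have "\<dots> \<le> 2 * F / e * (e / 8 + e / 8)"
        using cod.diff_le[of "w + a *\<^sub>R z - T y1" "w - T y2"] y1 y2 e F w z T12
        by (intro mult_left_mono) auto
      also have "\<dots> = F / 2"
        using e by simp
      finally show ?thesis
        using y Ny z linear_map_on_mem[OF lin y] by (auto simp: F_def)
    qed
  qed (use e in auto)
  then show ?thesis
    using e by (intro exI[of _ "2 * (4 * real n / e)"]) auto
qed

end

section \<open>Separable images and extension from a dense subspace\<close>

context p_normed_pair
begin

lemma separable_subspace_image:
  assumes U: "separable_subspace p U V N" and T: "bounded_linear_on V N W M T"
  shows "separable_subspace p (T ` U) W M"
proof -
  note lin = bounded_linear_on_imp_linear[OF T]
  obtain C where C: "0 \<le> C" "\<And>x. x \<in> V \<Longrightarrow> M (T x) powr p \<le> C * N x powr p"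
    by (rule bounded_linear_onE[OF T]) (rule that)
  have sub: "subspace U" "U \<subseteq> V"
    using U by (simp_all add: dom.separable_subspace_iff)
  obtain D where D: "countable D" "D \<subseteq> V" "\<And>x e. x \<in> U \<Longrightarrow> 0 < e \<Longrightarrow> \<exists>d\<in>D. N (x - d) powr p < e"
    using U unfolding dom.separable_subspace_iff by (elim conjE exE) (simp add: that)
  have mem: "x \<in> V" if "x \<in> U" for x
    using that sub by blast
  have "subspace (T ` U)"
    unfolding subspace_def
  proof (intro conjI ballI allI)
    show "0 \<in> T ` U"
      using linear_map_on_0[OF lin dom.subspace] subspace_0[OF sub(1)] by force
    show "x + y \<in> T ` U" if "x \<in> T ` U" "y \<in> T ` U" for x y
      using that subspace_add[OF sub(1)] by (auto simp: mem simp flip: linear_map_on_add[OF lin])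
    show "a *\<^sub>R x \<in> T ` U" if "x \<in> T ` U" for a x
      using that subspace_scale[OF sub(1)] by (auto simp: mem simp flip: linear_map_on_scale[OF lin])
  qed
  moreover have "T ` U \<subseteq> W" "T ` D \<subseteq> W"
    using mem D(2) linear_map_on_mem[OF lin] by blast+
  moreover have "\<exists>d\<in>T ` D. M (T x - d) powr p < e" if "x \<in> U" "0 < e" for x e
  proof -
    obtain d where d: "d \<in> D" "N (x - d) powr p < e / (C + 1)"
      using D(3)[of x "e / (C + 1)"] \<open>x \<in> U\<close> \<open>0 < e\<close> C(1) by auto
    have "d \<in> V" "x \<in> V"
      using d D(2) mem \<open>x \<in> U\<close> by auto
    then have "M (T x - T d) powr p \<le> C * N (x - d) powr p"
      using C(2)[of "x - d"] by (simp add: linear_map_on_diff[OF lin dom.subspace])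
    also have "\<dots> \<le> C * (e / (C + 1))"
      using d C(1) by (intro mult_left_mono) auto
    also have "\<dots> < e"
      using C(1) \<open>0 < e\<close> by (simp add: field_simps)
    finally show ?thesis
      using d by blast
  qed
  ultimately show ?thesis
    using D(1) unfolding cod.separable_subspace_iff by (intro conjI exI[of _ "T ` D"]) auto
qed

text \<open>The value at x is the limit of \<open>S (u n)\<close> along a sequence in
  \<open>U\<close> tending to x. Treated as a relation compatible with sums and multiples, it
  becomes a linear function through the single estimate \<open>bound\<close>.\<close>

lemma bounded_linear_extension:
  assumes complete: "p_banach p W M" and U: "subspace U" "U \<subseteq> V"
    and dense: "\<And>x e. x \<in> V \<Longrightarrow> 0 < e \<Longrightarrow> \<exists>u\<in>U. N (x - u) powr p < e"
    and lin: "linear_map_on U W S"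
    and C: "0 \<le> C" "\<And>u. u \<in> U \<Longrightarrow> M (S u) powr p \<le> C * N u powr p"
  shows "\<exists>T. linear_map_on V W T \<and> (\<forall>x\<in>V. M (T x) powr p \<le> C * N x powr p) \<and> (\<forall>u\<in>U. T u = S u)"
proof -
  define R where "R x y \<longleftrightarrow> y \<in> W \<and> (\<exists>u. (\<forall>n::nat. u n \<in> U) \<and> (\<lambda>n. N (x - u n) powr p) \<longlonglongrightarrow> 0 \<and>
    (\<lambda>n. M (y - S (u n)) powr p) \<longlonglongrightarrow> 0)" for x y
  have mem: "x \<in> V" if "x \<in> U" for x
    using that U by blast
  note Smem = linear_map_on_mem[OF lin]
  have total: "\<exists>y. R x y" if x: "x \<in> V" for x
  proof -
    \<comment> \<open>Approximants of geometric speed let \<open>geometric_limit\<close> apply to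
      the images \<open>S (u n)\<close>.\<close>
    have "\<forall>n::nat. \<exists>u\<in>U. N (x - u) powr p < (1/2)^n"
      using dense[OF x] by simp
    then obtain u where u: "u n \<in> U" "N (x - u n) powr p < (1/2)^n" for n :: nat
      by metis
    have step: "M (S (u (Suc n)) - S (u n)) powr p \<le> (2 * C) * (1/2)^n" for n
    proof -
      have "M (S (u (Suc n)) - S (u n)) powr p \<le> C * N (u (Suc n) - u n) powr p"
        using C(2)[of "u (Suc n) - u n"] u(1) subspace_diff[OF U(1)]
        by (simp add: linear_map_on_diff[OF lin U(1)])
      also have "\<dots> \<le> C * (N (u (Suc n) - x) powr p + N (x - u n) powr p)"
        using C(1) x u(1) mem by (intro mult_left_mono dom.diff_triangle) auto
      also have "N (u (Suc n) - x) powr p = N (x - u (Suc n)) powr p"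
        using x u(1) mem by (intro dom.minus_commute) auto
      also have "C * (N (x - u (Suc n)) powr p + N (x - u n) powr p) \<le> C * ((1/2)^n + (1/2)^n)"
      proof (intro mult_left_mono add_mono C(1))
        show "N (x - u (Suc n)) powr p \<le> (1/2)^n"
          by (rule order_trans[OF less_imp_le[OF u(2)]]) simp
      qed (rule less_imp_le[OF u(2)])
      finally show ?thesis by simp
    qed
    have SW: "S (u n) \<in> W" for n
      using u(1) by (rule Smem)
    obtain y where y: "y \<in> W" "\<And>n. M (y - S (u n)) powr p \<le> 2 * (2 * C) * (1/2)^n"
      by (rule cod.geometric_limit[OF complete SW step]) (rule that)
    have "(\<lambda>n. N (x - u n) powr p) \<longlonglongrightarrow> 0"
    proof (rule Lim_null_comparison)
      show "(\<lambda>n. (1/2::real)^n) \<longlonglongrightarrow> 0"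
        by (intro LIMSEQ_power_zero) simp
      show "\<forall>\<^sub>F n in sequentially. norm (N (x - u n) powr p) \<le> (1/2)^n"
        using u(2) by (intro always_eventually allI) (simp add: less_imp_le)
    qed
    moreover have "(\<lambda>n. M (y - S (u n)) powr p) \<longlonglongrightarrow> 0"
    proof (rule Lim_null_comparison)
      have "(\<lambda>n. 2 * (2 * C) * (1/2::real)^n) \<longlonglongrightarrow> 2 * (2 * C) * 0"
        by (intro tendsto_mult_left LIMSEQ_power_zero) simp
      then show "(\<lambda>n. 2 * (2 * C) * (1/2::real)^n) \<longlonglongrightarrow> 0"
        by simp
    qed (use y(2) in auto)
    ultimately show ?thesis
      unfolding R_def using y(1) u(1) by blast
  qed
  have add: "R (x + x') (y + y')" if R: "R x y" "R x' y'" and V: "x \<in> V" "x' \<in> V" for x y x' y'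
  proof -
    obtain u where u: "y \<in> W" "\<forall>n. u n \<in> U" "(\<lambda>n. N (x - u n) powr p) \<longlonglongrightarrow> 0"
        "(\<lambda>n. M (y - S (u n)) powr p) \<longlonglongrightarrow> 0"
      using R(1) unfolding R_def by (elim conjE exE) (rule that)
    obtain v where v: "y' \<in> W" "\<forall>n. v n \<in> U" "(\<lambda>n. N (x' - v n) powr p) \<longlonglongrightarrow> 0"
        "(\<lambda>n. M (y' - S (v n)) powr p) \<longlonglongrightarrow> 0"
      using R(2) unfolding R_def by (elim conjE exE) (rule that)
    have "(\<lambda>n. N (x + x' - (u n + v n)) powr p) \<longlonglongrightarrow> 0"
    proof (rule Lim_null_comparison)
      show "\<forall>\<^sub>F n in sequentially. norm (N (x + x' - (u n + v n)) powr p)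
          \<le> N (x - u n) powr p + N (x' - v n) powr p"
        using u(2) v(2) V mem by (auto simp: add_diff_add intro!: always_eventually dom.triangle)
      show "(\<lambda>n. N (x - u n) powr p + N (x' - v n) powr p) \<longlonglongrightarrow> 0"
        using tendsto_add[OF u(3) v(3)] by simp
    qed
    moreover have "(\<lambda>n. M (y + y' - S (u n + v n)) powr p) \<longlonglongrightarrow> 0"
    proof (rule Lim_null_comparison)
      show "\<forall>\<^sub>F n in sequentially. norm (M (y + y' - S (u n + v n)) powr p)
          \<le> M (y - S (u n)) powr p + M (y' - S (v n)) powr p"
        using u(1,2) v(1,2) Smem
        by (auto simp: linear_map_on_add[OF lin] add_diff_add intro!: always_eventually cod.triangle)
      show "(\<lambda>n. M (y - S (u n)) powr p + M (y' - S (v n)) powr p) \<longlonglongrightarrow> 0"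
        using tendsto_add[OF u(4) v(4)] by simp
    qed
    ultimately show ?thesis
      unfolding R_def using u(1,2) v(1,2) subspace_add[OF U(1)]
      by (intro conjI exI[of _ "\<lambda>n. u n + v n"]) auto
  qed
  have scale: "R (a *\<^sub>R x) (a *\<^sub>R y)" if R: "R x y" and V: "x \<in> V" for a x y
  proof -
    obtain u where u: "y \<in> W" "\<forall>n. u n \<in> U" "(\<lambda>n. N (x - u n) powr p) \<longlonglongrightarrow> 0"
        "(\<lambda>n. M (y - S (u n)) powr p) \<longlonglongrightarrow> 0"
      using R(1) unfolding R_def by (elim conjE exE) (rule that)
    have "(\<lambda>n. N (a *\<^sub>R x - a *\<^sub>R u n) powr p) \<longlonglongrightarrow> 0"
      using tendsto_mult_left[OF u(3), of "\<bar>a\<bar> powr p"] u(2) V mem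
      by (simp add: dom.scale_powr flip: scaleR_diff_right)
    moreover have "(\<lambda>n. M (a *\<^sub>R y - S (a *\<^sub>R u n)) powr p) \<longlonglongrightarrow> 0"
      using tendsto_mult_left[OF u(4), of "\<bar>a\<bar> powr p"] u(1,2) Smem
      by (simp add: cod.scale_powr linear_map_on_scale[OF lin] flip: scaleR_diff_right)
    ultimately show ?thesis
      unfolding R_def using u(1,2) subspace_scale[OF U(1)]
      by (intro conjI exI[of _ "\<lambda>n. a *\<^sub>R u n"]) auto
  qed
  have bound: "M y powr p \<le> C * N x powr p" if R: "R x y" and V: "x \<in> V" for x y
  proof -
    obtain u where u: "y \<in> W" "\<forall>n. u n \<in> U" "(\<lambda>n. N (x - u n) powr p) \<longlonglongrightarrow> 0"
        "(\<lambda>n. M (y - S (u n)) powr p) \<longlonglongrightarrow> 0"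
      using R(1) unfolding R_def by (elim conjE exE) (rule that)
    have "(\<lambda>n. M (y - S (u n)) powr p + C * (N (x - u n) powr p + N x powr p)) \<longlonglongrightarrow>
        0 + C * (0 + N x powr p)"
      by (intro tendsto_intros u)
    moreover have "M y powr p \<le> M (y - S (u n)) powr p + C * (N (x - u n) powr p + N x powr p)" for n
    proof -
      have un: "u n \<in> U" "u n \<in> V" "S (u n) \<in> W"
        using u(2) mem Smem by auto
      have "M y powr p \<le> M (y - S (u n)) powr p + M (S (u n)) powr p"
        using u(1) un by (intro cod.le_diff)
      also have "M (S (u n)) powr p \<le> C * N (u n) powr p"
        using un by (intro C)
      also have "C * N (u n) powr p \<le> C * (N (u n - x) powr p + N x powr p)"
        using un V C(1) by (intro mult_left_mono dom.le_diff)
      finally show ?thesis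
        using un V by (simp add: dom.minus_commute)
    qed
    ultimately have "M y powr p \<le> 0 + C * (0 + N x powr p)"
      by (intro LIMSEQ_le_const) auto
    then show ?thesis by simp
  qed
  \<comment> \<open>Two values at x make their difference a value at 0, where \<open>bound\<close>
    forces it to vanish.\<close>
  have unique: "y = y'" if R: "R x y" "R x y'" and V: "x \<in> V" for x y y'
  proof -
    have W: "y \<in> W" "y' \<in> W"
      using R by (auto simp: R_def)
    have "-1 *\<^sub>R x \<in> V"
      using V by (rule dom.closed_simps)
    then have "R (x + -1 *\<^sub>R x) (y + -1 *\<^sub>R y')"
      using R V by (intro add scale)
    then have "M (y + -1 *\<^sub>R y') powr p \<le> C * N 0 powr p"
      using bound[of "x + -1 *\<^sub>R x"] by simp
    then have "M (y - y') powr p \<le> 0"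
      by simp
    then show ?thesis
      using W by (intro cod.eq_if_small) auto
  qed
  define T where "T x = (SOME y. R x y)" for x
  have T: "R x (T x)" if "x \<in> V" for x
    unfolding T_def using total[OF that] by (rule someI_ex)
  have "linear_map_on V W T"
    unfolding linear_map_on_def
  proof (intro conjI ballI allI funcsetI)
    show "T x \<in> W" if "x \<in> V" for x
      using T[OF that] by (simp add: R_def)
    show "T (x + y) = T x + T y" if "x \<in> V" "y \<in> V" for x y
      using that by (intro unique[of "x + y"] T add) auto
    show "T (a *\<^sub>R x) = a *\<^sub>R T x" if "x \<in> V" for a x
      using that by (intro unique[of "a *\<^sub>R x"] T scale) auto
  qed
  moreover have "T u = S u" if "u \<in> U" for u
  proof (rule unique[OF T])
    show "R u (S u)"
      unfolding R_def using that Smem by (intro conjI exI[of _ "\<lambda>_. u"]) auto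
  qed (use that mem in auto)
  ultimately show ?thesis
    using bound T by blast
qed

end

section \<open>The spaces $\ell_p$\<close>

text \<open>After division by the sum of the absolute values, both quotients lie in [0,1], where t
  \<le> t powr p because p \<le> 1; and the quotients add up to 1.\<close>

lemma powr_abs_add_le:
  fixes a b p :: real
  assumes "0 < p" "p \<le> 1"
  shows "\<bar>a + b\<bar> powr p \<le> \<bar>a\<bar> powr p + \<bar>b\<bar> powr p"
proof (cases "\<bar>a\<bar> + \<bar>b\<bar> = 0")
  case False
  define s where "s = \<bar>a\<bar> + \<bar>b\<bar>"
  have s: "0 < s"
    using False by (simp add: s_def)
  have *: "s powr p * (\<bar>c\<bar> / s) \<le> \<bar>c\<bar> powr p" if "\<bar>c\<bar> \<le> s" for c
  proof -
    have "(\<bar>c\<bar> / s) powr 1 \<le> (\<bar>c\<bar> / s) powr p"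
      using that s assms by (intro powr_mono') auto
    then have "s powr p * (\<bar>c\<bar> / s) \<le> s powr p * (\<bar>c\<bar> / s) powr p"
      using s by (intro mult_left_mono) auto
    also have "\<dots> = \<bar>c\<bar> powr p"
      using s by (simp add: powr_divide)
    finally show ?thesis .
  qed
  have "\<bar>a + b\<bar> powr p \<le> s powr p"
    using assms by (intro powr_mono2) (auto simp: s_def)
  also have "\<dots> = s powr p * (\<bar>a\<bar> / s) + s powr p * (\<bar>b\<bar> / s)"
    using s by (simp flip: distrib_left add_divide_distrib s_def)
  also have "\<dots> \<le> \<bar>a\<bar> powr p + \<bar>b\<bar> powr p"
    by (intro add_mono *) (auto simp: s_def)
  finally show ?thesis .
next
  case True
  then have "a = 0" "b = 0"
    by auto
  then show ?thesis by simp
qed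

definition basis_vec :: "'i \<Rightarrow> 'i \<Rightarrow> real" where
  "basis_vec k = (\<lambda>i. if i = k then 1 else 0)"

definition restr :: "'i set \<Rightarrow> ('i \<Rightarrow> real) \<Rightarrow> 'i \<Rightarrow> real" where
  "restr A f = (\<lambda>i. if i \<in> A then f i else 0)"

definition lp_on :: "real \<Rightarrow> 'i set \<Rightarrow> ('i \<Rightarrow> real) set" where
  "lp_on p A = {f \<in> lp_space p. \<forall>k. k \<notin> A \<longrightarrow> f k = 0}"

lemma lp_norm_powr: "0 < p \<Longrightarrow> lp_norm p f powr p = (\<Sum>\<^sub>\<infinity>i. \<bar>f i\<bar> powr p)"
  by (simp add: lp_norm_def powr_powr infsum_nonneg)

lemma lp_spaceI:
  assumes "0 < p" "\<And>B. finite B \<Longrightarrow> (\<Sum>i\<in>B. \<bar>f i\<bar> powr p) \<le> c"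
  shows "f \<in> lp_space p" "lp_norm p f powr p \<le> c"
proof -
  have *: "(\<lambda>i. \<bar>f i\<bar> powr p) summable_on UNIV"
    using assms(2) by (intro nonneg_bdd_above_summable_on bdd_aboveI[of _ c]) auto
  then show "f \<in> lp_space p"
    by (simp add: lp_space_def)
  show "lp_norm p f powr p \<le> c"
    unfolding lp_norm_powr[OF assms(1)] using * assms(2) by (intro infsum_le_finite_sums) auto
qed

lemma lp_sum_le:
  assumes "0 < p" "f \<in> lp_space p" "finite B"
  shows "(\<Sum>i\<in>B. \<bar>f i\<bar> powr p) \<le> lp_norm p f powr p"
  unfolding lp_norm_powr[OF assms(1)]
  using assms(2,3) by (intro finite_sum_le_infsum) (auto simp: lp_space_def)

lemma lp_coord_le: "0 < p \<Longrightarrow> f \<in> lp_space p \<Longrightarrow> \<bar>f i\<bar> powr p \<le> lp_norm p f powr p"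
  using lp_sum_le[of p f "{i}"] by simp

lemma lp_finite_support:
  assumes "0 < p" "finite A" "\<And>k. k \<notin> A \<Longrightarrow> f k = 0"
  shows "f \<in> lp_space p" "lp_norm p f powr p = (\<Sum>i\<in>A. \<bar>f i\<bar> powr p)"
proof -
  have "(\<Sum>i\<in>B. \<bar>f i\<bar> powr p) \<le> (\<Sum>i\<in>A. \<bar>f i\<bar> powr p)" if "finite B" for B
  proof -
    have "(\<Sum>i\<in>B. \<bar>f i\<bar> powr p) = (\<Sum>i\<in>A \<inter> B. \<bar>f i\<bar> powr p)"
      using that assms by (intro sum.mono_neutral_right) auto
    also have "\<dots> \<le> (\<Sum>i\<in>A. \<bar>f i\<bar> powr p)"
      using assms by (intro sum_mono2) auto
    finally show ?thesis .
  qed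
  note * = lp_spaceI[OF assms(1) this]
  show "f \<in> lp_space p"
    by (rule *)
  then show "lp_norm p f powr p = (\<Sum>i\<in>A. \<bar>f i\<bar> powr p)"
    using * lp_sum_le[OF assms(1) _ assms(2)] by (intro antisym) auto
qed

lemma lp_p_normed_space:
  assumes "0 < p" "p \<le> 1"
  shows "p_normed_space p (lp_space p :: ('i \<Rightarrow> real) set) (lp_norm p)"
proof
  have add: "f + g \<in> lp_space p \<and> lp_norm p (f + g) powr p \<le> lp_norm p f powr p + lp_norm p g powr p"
    if "f \<in> lp_space p" "g \<in> lp_space p" for f g :: "'i \<Rightarrow> real"
  proof -
    have "(\<Sum>i\<in>B. \<bar>(f + g) i\<bar> powr p) \<le> lp_norm p f powr p + lp_norm p g powr p" if "finite B" for B
    proof -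
      have "(\<Sum>i\<in>B. \<bar>(f + g) i\<bar> powr p) \<le> (\<Sum>i\<in>B. \<bar>f i\<bar> powr p + \<bar>g i\<bar> powr p)"
        using powr_abs_add_le[OF assms] by (intro sum_mono) simp
      also have "\<dots> \<le> lp_norm p f powr p + lp_norm p g powr p"
        unfolding sum.distrib
        using assms \<open>f \<in> _\<close> \<open>g \<in> _\<close> that by (intro add_mono lp_sum_le)
      finally show ?thesis .
    qed
    from lp_spaceI[OF assms(1), of "f + g", OF this] show ?thesis by simp
  qed
  have scale: "a *\<^sub>R f \<in> lp_space p \<and> lp_norm p (a *\<^sub>R f) = \<bar>a\<bar> * lp_norm p f"
    if "f \<in> lp_space p" for a and f :: "'i \<Rightarrow> real"
  proof -
    have eq: "(\<lambda>i. \<bar>(a *\<^sub>R f) i\<bar> powr p) = (\<lambda>i. \<bar>a\<bar> powr p * \<bar>f i\<bar> powr p)"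
      by (simp add: scaleR_fun_def abs_mult powr_mult)
    have *: "(\<lambda>i. \<bar>f i\<bar> powr p) summable_on UNIV"
      using that by (simp add: lp_space_def)
    then have "lp_norm p (a *\<^sub>R f) = (\<bar>a\<bar> powr p * (\<Sum>\<^sub>\<infinity>i. \<bar>f i\<bar> powr p)) powr (1 / p)"
      unfolding lp_norm_def eq by (simp add: infsum_cmult_right)
    also have "\<dots> = \<bar>a\<bar> * lp_norm p f"
      using assms by (simp add: lp_norm_def powr_mult powr_powr infsum_nonneg)
    finally show ?thesis
      using * by (simp add: lp_space_def eq summable_on_cmult_right)
  qed
  have zero: "lp_norm p f = 0 \<longleftrightarrow> f = 0" if "f \<in> lp_space p" for f :: "'i \<Rightarrow> real"
  proof
    assume *: "lp_norm p f = 0"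
    show "f = 0"
    proof
      fix i
      have "\<bar>f i\<bar> powr p \<le> 0"
        using lp_coord_le[OF assms(1) that, of i] * by simp
      then show "f i = 0 i"
        by simp
    qed
  next
    assume "f = 0"
    then show "lp_norm p f = 0"
      by (simp add: lp_norm_def)
  qed
  have "0 \<in> (lp_space p :: ('i \<Rightarrow> real) set)"
    by (simp add: lp_space_def)
  then have "subspace (lp_space p :: ('i \<Rightarrow> real) set)"
    unfolding subspace_def using add scale by blast
  moreover have "0 \<le> lp_norm p f" for f :: "'i \<Rightarrow> real"
    by (simp add: lp_norm_def)
  ultimately show "p_normed p (lp_space p :: ('i \<Rightarrow> real) set) (lp_norm p)"
    unfolding p_normed_def using add scale zero by (intro conjI ballI allI) auto
qed (rule assms(1))

text \<open>Coordinates converge by completeness of the reals. Bounds on finite sums of coordinates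
  pass to the limit, as in Fatou's lemma; this puts the limit in the space and gives convergence in
  norm.\<close>

lemma lp_p_banach:
  assumes "0 < p" "p \<le> 1"
  shows "p_banach p (lp_space p :: ('i \<Rightarrow> real) set) (lp_norm p)"
proof -
  interpret p_normed_space p "lp_space p :: ('i \<Rightarrow> real) set" "lp_norm p"
    using assms by (rule lp_p_normed_space)
  show ?thesis
    unfolding p_banach_iff
  proof (intro allI impI, elim conjE)
    fix \<sigma> :: "nat \<Rightarrow> 'i \<Rightarrow> real"
    assume "range \<sigma> \<subseteq> lp_space p"
      and Cauchy: "\<forall>e>0. \<exists>n0. \<forall>m\<ge>n0. \<forall>n\<ge>n0. lp_norm p (\<sigma> m - \<sigma> n) powr p < e"
    then have \<sigma>: "\<sigma> n \<in> lp_space p" for n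
      by auto
    have "Cauchy (\<lambda>n. \<sigma> n k)" for k
      unfolding Cauchy_def
    proof (intro allI impI)
      fix e :: real assume "0 < e"
      then obtain n0 where n0: "\<And>m n. n0 \<le> m \<Longrightarrow> n0 \<le> n \<Longrightarrow> lp_norm p (\<sigma> m - \<sigma> n) powr p < e powr p"
        using Cauchy[rule_format, of "e powr p"] by auto
      have "dist (\<sigma> m k) (\<sigma> n k) < e" if "n0 \<le> m" "n0 \<le> n" for m n
      proof -
        have "\<bar>(\<sigma> m - \<sigma> n) k\<bar> powr p \<le> lp_norm p (\<sigma> m - \<sigma> n) powr p"
          using \<sigma> assms by (intro lp_coord_le closed_simps)
        also have "\<dots> < e powr p"
          using n0 that by blast
        finally have "\<bar>(\<sigma> m - \<sigma> n) k\<bar> < e"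
          using \<open>0 < e\<close> assms powr_mono2[of p e "\<bar>(\<sigma> m - \<sigma> n) k\<bar>"] by (meson less_imp_le not_le)
        then show ?thesis
          by (simp add: dist_real_def)
      qed
      then show "\<exists>M. \<forall>m\<ge>M. \<forall>n\<ge>M. dist (\<sigma> m k) (\<sigma> n k) < e"
        by blast
    qed
    then have "\<forall>k. \<exists>l. (\<lambda>n. \<sigma> n k) \<longlonglongrightarrow> l"
      unfolding Cauchy_convergent_iff convergent_def ..
    then obtain g where g: "\<And>k. (\<lambda>n. \<sigma> n k) \<longlonglongrightarrow> g k"
      by metis
    have tail: "\<sigma> n - g \<in> lp_space p \<and> lp_norm p (\<sigma> n - g) powr p \<le> e"
      if n: "\<And>m. n0 \<le> m \<Longrightarrow> lp_norm p (\<sigma> n - \<sigma> m) powr p < e" for n n0 e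
    proof -
      have "(\<Sum>i\<in>B. \<bar>(\<sigma> n - g) i\<bar> powr p) \<le> e" if "finite B" for B
      proof (rule LIMSEQ_le_const2)
        have "(\<lambda>m. \<bar>\<sigma> n i - \<sigma> m i\<bar> powr p) \<longlonglongrightarrow> \<bar>\<sigma> n i - g i\<bar> powr p" for i
          using assms by (intro tendsto_powr' tendsto_rabs tendsto_diff tendsto_const g) auto
        then show "(\<lambda>m. \<Sum>i\<in>B. \<bar>(\<sigma> n - \<sigma> m) i\<bar> powr p) \<longlonglongrightarrow> (\<Sum>i\<in>B. \<bar>(\<sigma> n - g) i\<bar> powr p)"
          by (intro tendsto_sum) simp
        have "(\<Sum>i\<in>B. \<bar>(\<sigma> n - \<sigma> m) i\<bar> powr p) \<le> e" if "n0 \<le> m" for m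
          by (rule order_trans[OF lp_sum_le less_imp_le[OF n[OF that]]])
            (use \<open>finite B\<close> assms \<sigma> in auto)
        then show "\<exists>N. \<forall>m\<ge>N. (\<Sum>i\<in>B. \<bar>(\<sigma> n - \<sigma> m) i\<bar> powr p) \<le> e"
          by blast
      qed
      from lp_spaceI[OF assms(1), of "\<sigma> n - g", OF this] show ?thesis by simp
    qed
    have conv: "\<exists>n0. \<forall>n\<ge>n0. \<sigma> n - g \<in> lp_space p \<and> lp_norm p (\<sigma> n - g) powr p \<le> e" if "0 < e" for e
      using Cauchy[rule_format, OF that] tail by meson
    obtain n where n: "\<sigma> n - g \<in> lp_space p"
      using conv[of 1] by auto
    have "\<sigma> n - (\<sigma> n - g) \<in> lp_space p"
      by (rule closed_simps(3)[OF \<sigma> n])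
    then have "g \<in> lp_space p"
      by simp
    moreover have "(\<lambda>n. lp_norm p (\<sigma> n - g) powr p) \<longlonglongrightarrow> 0"
    proof (rule LIMSEQ_I)
      fix e :: real assume "0 < e"
      then obtain n0 where "\<forall>n\<ge>n0. lp_norm p (\<sigma> n - g) powr p \<le> e / 2"
        using conv[of "e / 2"] by auto
      then show "\<exists>n0. \<forall>n\<ge>n0. norm (lp_norm p (\<sigma> n - g) powr p - 0) < e"
        using \<open>0 < e\<close> by (intro exI[of _ n0]) fastforce
    qed
    ultimately show "\<exists>g\<in>lp_space p. (\<lambda>n. lp_norm p (\<sigma> n - g) powr p) \<longlonglongrightarrow> 0"
      by blast
  qed
qed

lemma lp_finite_approx:
  assumes "0 < p" "f \<in> lp_space p" "0 < e"
  obtains A where "finite A" "lp_norm p (f - restr A f) powr p < e"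
proof -
  have sm: "(\<lambda>i. \<bar>f i\<bar> powr p) summable_on UNIV"
    using assms(2) by (simp add: lp_space_def)
  have "(sum (\<lambda>i. \<bar>f i\<bar> powr p) \<longlongrightarrow> (\<Sum>\<^sub>\<infinity>i. \<bar>f i\<bar> powr p)) (finite_subsets_at_top UNIV)"
    using sm by (rule infsum_tendsto)
  \<comment> \<open>Half of e, since bounding the finite sums of the remainder gives only a
    non-strict inequality.\<close>
  then have "\<forall>\<^sub>F A in finite_subsets_at_top UNIV. (\<Sum>\<^sub>\<infinity>i. \<bar>f i\<bar> powr p) - e / 2 < (\<Sum>i\<in>A. \<bar>f i\<bar> powr p)"
    using assms(3) by (intro order_tendstoD) auto
  then obtain A where A: "finite A" "lp_norm p f powr p - e / 2 < (\<Sum>i\<in>A. \<bar>f i\<bar> powr p)"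
    unfolding eventually_finite_subsets_at_top lp_norm_powr[OF assms(1)] by auto
  have "(\<Sum>i\<in>B. \<bar>(f - restr A f) i\<bar> powr p) \<le> e / 2" if "finite B" for B
  proof -
    have "(\<Sum>i\<in>B. \<bar>(f - restr A f) i\<bar> powr p) = (\<Sum>i\<in>B - A. \<bar>f i\<bar> powr p)"
      using that by (intro sum.mono_neutral_cong_right) (auto simp: restr_def)
    also have "\<dots> = (\<Sum>i\<in>A \<union> B. \<bar>f i\<bar> powr p) - (\<Sum>i\<in>A. \<bar>f i\<bar> powr p)"
      using that A(1) by (subst sum_diff[symmetric]) (auto intro!: sum.cong)
    also have "(\<Sum>i\<in>A \<union> B. \<bar>f i\<bar> powr p) \<le> lp_norm p f powr p"
      using that A(1) assms by (intro lp_sum_le) auto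
    finally show ?thesis
      using A(2) by simp
  qed
  then have "lp_norm p (f - restr A f) powr p \<le> e / 2"
    by (rule lp_spaceI[OF assms(1)])
  with A(1) assms(3) show thesis
    by (intro that) auto
qed

lemma scaleR_fun_apply: "(a *\<^sub>R f) x = a *\<^sub>R f x"
  by (simp add: scaleR_fun_def)

lemma sum_fun_apply: "sum f A x = (\<Sum>i\<in>A. f i x)"
  by (induction A rule: infinite_finite_induct) auto

lemma restr_finite: "finite A \<Longrightarrow> restr A f = (\<Sum>k\<in>A. f k *\<^sub>R basis_vec k)"
  by (rule ext) (simp add: restr_def basis_vec_def sum_fun_apply scaleR_fun_def if_distrib[of "(*) _"] cong: if_cong)

lemma basis_vec_lp:
  assumes "0 < p"
  shows "basis_vec k \<in> lp_space p" "lp_norm p (basis_vec k) powr p = 1"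
  using lp_finite_support[OF assms, of "{k}" "basis_vec k"] by (auto simp: basis_vec_def)

lemma restr_lp:
  assumes "0 < p" "f \<in> lp_space p"
  shows "restr A f \<in> lp_space p" "lp_norm p (restr A f) powr p \<le> lp_norm p f powr p"
proof -
  have "(\<Sum>i\<in>B. \<bar>restr A f i\<bar> powr p) \<le> lp_norm p f powr p" if "finite B" for B
  proof -
    have "(\<Sum>i\<in>B. \<bar>restr A f i\<bar> powr p) \<le> (\<Sum>i\<in>B. \<bar>f i\<bar> powr p)"
      by (intro sum_mono) (simp add: restr_def)
    also have "\<dots> \<le> lp_norm p f powr p"
      using assms that by (intro lp_sum_le)
    finally show ?thesis .
  qed
  note * = lp_spaceI[OF assms(1), of "restr A f", OF this]
  show "restr A f \<in> lp_space p" "lp_norm p (restr A f) powr p \<le> lp_norm p f powr p"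
    using * by auto
qed

lemma restr_basis_vec: "restr A (basis_vec k) = (if k \<in> A then basis_vec k else 0)"
  by (auto simp: restr_def basis_vec_def fun_eq_iff)

lemma lp_on_iff: "f \<in> lp_on p A \<longleftrightarrow> f \<in> lp_space p \<and> restr A f = f"
  by (auto simp: lp_on_def restr_def fun_eq_iff)

lemma lp_on_subset: "lp_on p A \<subseteq> lp_space p"
  by (auto simp: lp_on_def)

lemma lp_on_mono: "A \<subseteq> B \<Longrightarrow> lp_on p A \<subseteq> lp_on p B"
  by (auto simp: lp_on_def)

lemma basis_vec_lp_on: "0 < p \<Longrightarrow> k \<in> A \<Longrightarrow> basis_vec k \<in> lp_on p A"
  by (auto simp: lp_on_iff basis_vec_lp restr_basis_vec)

text \<open>Exhibits the subspace as a kernel, so that \<open>p_banach_kernel\<close> gives its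
  completeness.\<close>

lemma lp_on_eq_kernel: "lp_on p A = kernel_on (lp_space p) (restr (- A))"
  by (auto simp: lp_on_def kernel_on_def restr_def fun_eq_iff)

(* The parameter ty only serves to fix the index type. *)

locale lp_operators = cod: p_normed_space p W M
  for p :: real and W :: "'b::real_vector set" and M :: "'b \<Rightarrow> real" and ty :: "'i itself" +
  assumes p_le_1: "p \<le> 1"
begin

sublocale p_normed_pair p "lp_space p :: ('i \<Rightarrow> real) set" "lp_norm p" W M
  using cod.p_pos p_le_1 cod.p_normed_space_axioms by (intro p_normed_pair.intro lp_p_normed_space)

text \<open>The universal property of l_p among p-Banach spaces. On finitely supported f the
  triangle inequality for p-th powers bounds \<open>M (S f) powr p\<close> by C times the sum of the
  \<open>\<bar>f k\<bar> powr p\<close>, and these f are dense. This is what permits lifts to be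
  chosen separately for each unit vector.\<close>

lemma lp_operator_exists:
  fixes s :: "'i \<Rightarrow> 'b"
  assumes complete: "p_banach p W M" and s: "\<And>k. s k \<in> W" "\<And>k. M (s k) powr p \<le> C"
  obtains T where "bounded_linear_on (lp_space p) (lp_norm p) W M T" "\<And>k. T (basis_vec k) = s k"
proof -
  define U :: "('i \<Rightarrow> real) set" where "U = {f. finite {k. f k \<noteq> 0}}"
  define S where "S f = (\<Sum>k | f k \<noteq> 0. f k *\<^sub>R s k)" for f
  have S: "S f = (\<Sum>k\<in>A. f k *\<^sub>R s k)" if "finite A" "{k. f k \<noteq> 0} \<subseteq> A" for f A
    unfolding S_def using that by (intro sum.mono_neutral_left) auto
  have U_add: "{k. (f + g) k \<noteq> 0} \<subseteq> {k. f k \<noteq> 0} \<union> {k. g k \<noteq> 0}" for f g :: "'i \<Rightarrow> real"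
    by auto
  have U_scale: "{k. (a *\<^sub>R f) k \<noteq> 0} \<subseteq> {k. f k \<noteq> 0}" for a and f :: "'i \<Rightarrow> real"
    by (auto simp: scaleR_fun_def)
  have C: "0 \<le> C"
    using order_trans[OF powr_ge_zero s(2)] .
  have "\<exists>T. linear_map_on (lp_space p) W T \<and>
      (\<forall>x\<in>lp_space p. M (T x) powr p \<le> C * lp_norm p x powr p) \<and> (\<forall>u\<in>U. T u = S u)"
  proof (rule bounded_linear_extension[OF complete _ _ _ _ C])
    show "subspace U"
      unfolding subspace_def
    proof (intro conjI ballI allI)
      show "f + g \<in> U" if "f \<in> U" "g \<in> U" for f g
        using that finite_subset[OF U_add] by (simp add: U_def del: plus_fun_apply)
      show "a *\<^sub>R f \<in> U" if "f \<in> U" for a f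
        using that finite_subset[OF U_scale] by (simp add: U_def)
    qed (simp add: U_def)
    show "U \<subseteq> lp_space p"
      using lp_finite_support(1)[OF cod.p_pos] by (auto simp: U_def)
    show "\<exists>u\<in>U. lp_norm p (f - u) powr p < e" if f: "f \<in> lp_space p" and e: "0 < e" for f and e :: real
    proof -
      obtain A where A: "finite A" "lp_norm p (f - restr A f) powr p < e"
        by (rule lp_finite_approx[OF cod.p_pos f e])
      then have "restr A f \<in> U"
        by (auto simp: U_def restr_def)
      with A show ?thesis by blast
    qed
    show "linear_map_on U W S"
      unfolding linear_map_on_def
    proof (intro conjI ballI allI funcsetI)
      show "S f \<in> W" if "f \<in> U" for f
        unfolding S_def using s by simp
      show "S (f + g) = S f + S g" if "f \<in> U" "g \<in> U" for f g
      proof -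
        let ?A = "{k. f k \<noteq> 0} \<union> {k. g k \<noteq> 0}"
        have fin: "finite ?A"
          using that by (simp add: U_def)
        have "S (f + g) = (\<Sum>k\<in>?A. (f + g) k *\<^sub>R s k)"
          by (rule S[OF fin U_add])
        also have "\<dots> = S f + S g"
          using S[OF fin, of f] S[OF fin, of g] by (simp add: sum.distrib scaleR_add_left)
        finally show ?thesis .
      qed
      show "S (a *\<^sub>R f) = a *\<^sub>R S f" if "f \<in> U" for a f
      proof -
        have "S (a *\<^sub>R f) = (\<Sum>k | f k \<noteq> 0. (a *\<^sub>R f) k *\<^sub>R s k)"
          using that by (intro S U_scale) (simp add: U_def)
        also have "\<dots> = a *\<^sub>R S f"
          by (simp add: S_def scaleR_sum_right scaleR_fun_def)
        finally show ?thesis .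
      qed
    qed
    show "M (S f) powr p \<le> C * lp_norm p f powr p" if "f \<in> U" for f
    proof -
      have "M (S f) powr p \<le> (\<Sum>k | f k \<noteq> 0. M (f k *\<^sub>R s k) powr p)"
        unfolding S_def using s by (intro cod.sum_le) auto
      also have "\<dots> \<le> (\<Sum>k | f k \<noteq> 0. \<bar>f k\<bar> powr p * C)"
        using s by (intro sum_mono) (simp add: cod.scale_powr mult_left_mono)
      also have "\<dots> = lp_norm p f powr p * C"
        unfolding sum_distrib_right[symmetric]
        using that by (subst lp_finite_support(2)[OF cod.p_pos, of "{k. f k \<noteq> 0}"]) (simp_all add: U_def)
      finally show ?thesis
        by (simp only: mult.commute)
    qed
  qed
  then obtain T where T: "linear_map_on (lp_space p) W T"
      "\<And>x. x \<in> lp_space p \<Longrightarrow> M (T x) powr p \<le> C * lp_norm p x powr p" "\<And>u. u \<in> U \<Longrightarrow> T u = S u"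
    by blast
  have supp: "{i. basis_vec k i \<noteq> 0} = {k}" for k :: 'i
    by (auto simp: basis_vec_def)
  have "T (basis_vec k) = s k" for k
    using T(3)[of "basis_vec k"] by (simp add: U_def S_def supp) (simp add: basis_vec_def)
  then show thesis
    using that bounded_linear_onI[OF T(1,2) C] by blast
qed

text \<open>The operators agree on the span of the unit vectors, which is dense, and both are
  continuous. Relations such as \<open>S (T f) = P (S f)\<close> thereby reduce to single unit
  vectors.\<close>

lemma lp_operator_eqI:
  fixes T T' :: "('i \<Rightarrow> real) \<Rightarrow> 'b"
  assumes T: "bounded_linear_on (lp_space p) (lp_norm p) W M T"
    and T': "bounded_linear_on (lp_space p) (lp_norm p) W M T'"
    and eq: "\<And>k. T (basis_vec k) = T' (basis_vec k)" and f: "f \<in> lp_space p"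
  shows "T f = T' f"
proof -
  note lin = bounded_linear_on_imp_linear[OF T] and lin' = bounded_linear_on_imp_linear[OF T']
  obtain C where C: "0 \<le> C" "\<And>x. x \<in> lp_space p \<Longrightarrow> M (T x) powr p \<le> C * lp_norm p x powr p"
    by (rule bounded_linear_onE[OF T]) (rule that)
  obtain C' where C': "0 \<le> C'" "\<And>x. x \<in> lp_space p \<Longrightarrow> M (T' x) powr p \<le> C' * lp_norm p x powr p"
    by (rule bounded_linear_onE[OF T']) (rule that)
  show ?thesis
  proof (rule cod.eq_if_small)
    show W: "T f \<in> W" "T' f \<in> W"
      using f linear_map_on_mem[OF lin] linear_map_on_mem[OF lin'] by auto
    fix e :: real assume "0 < e"
    \<comment> \<open>The summand 1 keeps the denominator positive when both constants are
      0.\<close>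
    define d where "d = e / (C + C' + 1)"
    have d: "0 < d" "(C + C') * d \<le> e"
      using \<open>0 < e\<close> C(1) C'(1) by (auto simp: d_def field_simps)
    obtain A where A: "finite A" "lp_norm p (f - restr A f) powr p < d"
      by (rule lp_finite_approx[OF cod.p_pos f d(1)])
    have g: "restr A f \<in> lp_space p" "f - restr A f \<in> lp_space p"
      using f restr_lp[OF cod.p_pos f] by auto
    have mem: "f k *\<^sub>R basis_vec k \<in> lp_space p" for k
      using basis_vec_lp(1)[OF cod.p_pos] by (rule dom.closed_simps)
    have "T (restr A f) = T' (restr A f)"
      unfolding restr_finite[OF A(1)] linear_map_on_sum[OF lin dom.subspace mem]
        linear_map_on_sum[OF lin' dom.subspace mem]
        linear_map_on_scale[OF lin basis_vec_lp(1)[OF cod.p_pos]]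
        linear_map_on_scale[OF lin' basis_vec_lp(1)[OF cod.p_pos]] eq ..
    then have "T f - T' f = T (f - restr A f) - T' (f - restr A f)"
      using f g by (simp add: linear_map_on_diff[OF lin dom.subspace] linear_map_on_diff[OF lin' dom.subspace])
    then have "M (T f - T' f) powr p \<le> M (T (f - restr A f)) powr p + M (T' (f - restr A f)) powr p"
      using g linear_map_on_mem[OF lin] linear_map_on_mem[OF lin'] by (simp add: cod.diff_le)
    also have "\<dots> \<le> (C + C') * lp_norm p (f - restr A f) powr p"
      using C(2)[OF g(2)] C'(2)[OF g(2)] by (simp add: distrib_right)
    also have "\<dots> \<le> (C + C') * d"
      using A(2) C(1) C'(1) by (intro mult_left_mono) auto
    also have "\<dots> \<le> e"
      by (rule d)
    finally show "M (T f - T' f) powr p \<le> e" .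
  qed
qed

end

section \<open>Vectors supported on a given index set\<close>

lemma restr_bounded_linear:
  fixes A :: "'i set"
  assumes "0 < p" "p \<le> 1"
  shows "bounded_linear_on (lp_space p) (lp_norm p) (lp_space p) (lp_norm p) (restr A)"
proof -
  interpret lp_operators p "lp_space p :: ('i \<Rightarrow> real) set" "lp_norm p" "TYPE('i)"
    using assms by (intro lp_operators.intro lp_p_normed_space lp_operators_axioms.intro)
  show ?thesis
  proof (rule bounded_linear_onI)
    show "linear_map_on (lp_space p) (lp_space p) (restr A)"
      using restr_lp[OF assms(1)] by (auto simp: linear_map_on_def restr_def scaleR_fun_def fun_eq_iff)
    show "lp_norm p (restr A f) powr p \<le> 1 * lp_norm p f powr p" if "f \<in> lp_space p" for f
      using restr_lp(2)[OF assms(1) that] by simp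
  qed simp
qed

lemma lp_on_p_banach:
  fixes A :: "'i set"
  assumes "0 < p" "p \<le> 1"
  shows "p_banach p (lp_on p A) (lp_norm p)"
proof -
  interpret lp_operators p "lp_space p :: ('i \<Rightarrow> real) set" "lp_norm p" "TYPE('i)"
    using assms by (intro lp_operators.intro lp_p_normed_space lp_operators_axioms.intro)
  show ?thesis
    unfolding lp_on_eq_kernel using assms by (intro p_banach_kernel lp_p_banach restr_bounded_linear)
qed

lemma lp_on_separable:
  fixes A :: "'i set"
  assumes "0 < p" "p \<le> 1" "countable A"
  shows "separable_subspace p (lp_on p A) (lp_space p) (lp_norm p)"
proof -
  interpret p_normed_space p "lp_space p :: ('i \<Rightarrow> real) set" "lp_norm p"
    using assms by (intro lp_p_normed_space)
  \<comment> \<open>The finitely supported rational vectors. Restricting to functions in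
    \<open>PiE B\<close> keeps the parametrising set countable, as these are determined by their
    values on the finite set \<open>B\<close>.\<close>
  define D :: "('i \<Rightarrow> real) set" where "D = (\<Union>B\<in>Fpow A. restr B ` (PiE B (\<lambda>_. \<rat>)))"
  have "countable D"
    unfolding D_def using assms(3) countable_rat
    by (intro countable_UN countable_Fpow countable_image countable_PiE) (auto simp: Fpow_def)
  moreover have "D \<subseteq> lp_space p"
  proof
    fix f assume "f \<in> D"
    then obtain B where "finite B" "\<And>k. k \<notin> B \<Longrightarrow> f k = 0"
      by (auto simp: D_def Fpow_def restr_def)
    then show "f \<in> lp_space p"
      by (rule lp_finite_support(1)[OF assms(1)])
  qed
  moreover have "\<exists>d\<in>D. lp_norm p (f - d) powr p < e" if f: "f \<in> lp_on p A" and e: "0 < e" for f e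
  proof -
    have f': "f \<in> lp_space p"
      using f by (simp add: lp_on_def)
    obtain B0 where B0: "finite B0" "lp_norm p (f - restr B0 f) powr p < e / 2"
      using lp_finite_approx[OF assms(1) f', of "e / 2"] e by auto
    define B where "B = B0 \<inter> A"
    have B: "finite B" "B \<subseteq> A" "restr B0 f = restr B f"
      using B0 f by (auto simp: B_def restr_def lp_on_def fun_eq_iff)
    \<comment> \<open>An equal share of e/2 for each coordinate; the summand 1 covers the case of
      empty \<open>B\<close>.\<close>
    define c where "c = e / (2 * (real (card B) + 1))"
    have c: "0 < c"
      using e by (simp add: c_def)
    have "\<exists>r\<in>\<rat>. \<bar>f k - r\<bar> powr p < c" for k
    proof -
      have "f k < f k + c powr (1/p)"
        using c by simp
      then obtain r where r: "r \<in> \<rat>" "f k < r" "r < f k + c powr (1/p)"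
        using Rats_dense_in_real by blast
      then have "\<bar>f k - r\<bar> powr p < (c powr (1/p)) powr p"
        using assms by (intro powr_less_mono2) auto
      then show ?thesis
        using r(1) c assms(1) by (intro bexI[of _ r]) (simp_all add: powr_powr)
    qed
    then obtain q where q: "\<And>k. q k \<in> \<rat>" "\<And>k. \<bar>f k - q k\<bar> powr p < c"
      by metis
    define d where "d = restr B q"
    have "d = restr B (restrict q B)"
      by (auto simp: d_def restr_def)
    moreover have "restrict q B \<in> PiE B (\<lambda>_. \<rat>)"
      using q by auto
    ultimately have "d \<in> D"
      unfolding D_def using B by (auto simp: Fpow_def)
    have "lp_norm p (restr B f - d) powr p = (\<Sum>k\<in>B. \<bar>(restr B f - d) k\<bar> powr p)"
      using B by (intro lp_finite_support(2)[OF assms(1)]) (auto simp: d_def restr_def)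
    also have "\<dots> \<le> (\<Sum>k\<in>B. c)"
      using less_imp_le[OF q(2)] by (intro sum_mono) (simp add: d_def restr_def)
    also have "\<dots> \<le> e / 2"
      using e by (simp add: c_def field_simps)
    finally have "lp_norm p (restr B f - d) powr p \<le> e / 2" .
    moreover have "lp_norm p (f - d) powr p \<le> lp_norm p (f - restr B f) powr p + lp_norm p (restr B f - d) powr p"
      using f' restr_lp[OF assms(1) f'] \<open>d \<in> D\<close> \<open>D \<subseteq> lp_space p\<close> by (intro diff_triangle) auto
    ultimately show ?thesis
      using B0(2) \<open>d \<in> D\<close> unfolding B(3) by (intro bexI[of _ d]) auto
  qed
  moreover have "subspace (lp_on p A)"
    unfolding subspace_def lp_on_def by (auto simp: scaleR_fun_apply)
  ultimately show ?thesis
    unfolding separable_subspace_iff using lp_on_subset by blast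
qed

text \<open>Summability makes the support of each vector countable, and a coordinate at which all
  members of an approximating set vanish is 0 in every limit as well.\<close>

lemma separable_lp_countable_support:
  fixes U :: "('i \<Rightarrow> real) set"
  assumes "0 < p" "p \<le> 1" "separable_subspace p U (lp_space p) (lp_norm p)"
  obtains A where "countable A" "U \<subseteq> lp_on p A"
proof -
  interpret p_normed_space p "lp_space p :: ('i \<Rightarrow> real) set" "lp_norm p"
    using assms by (intro lp_p_normed_space)
  obtain D where U: "U \<subseteq> lp_space p" and D: "countable D" "D \<subseteq> lp_space p"
    "\<And>x e. x \<in> U \<Longrightarrow> 0 < e \<Longrightarrow> \<exists>d\<in>D. lp_norm p (x - d) powr p < e"
    using assms(3) unfolding separable_subspace_iff by (elim conjE exE) (simp add: that)
  define A where "A = (\<Union>d\<in>D. {k. d k \<noteq> 0})"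
  have "countable {k. d k \<noteq> 0}" if "d \<in> D" for d
    using summable_countable_real[of "\<lambda>k. \<bar>d k\<bar> powr p" UNIV] that D(2) by (auto simp: lp_space_def)
  then have "countable A"
    unfolding A_def using D(1) by (intro countable_UN)
  moreover have "f k = 0" if f: "f \<in> U" and k: "k \<notin> A" for f k
  proof -
    have "\<bar>f k\<bar> powr p \<le> e" if e: "0 < e" for e
    proof -
      obtain d where d: "d \<in> D" "lp_norm p (f - d) powr p < e"
        using D(3)[OF f e] by blast
      have "\<bar>(f - d) k\<bar> powr p \<le> lp_norm p (f - d) powr p"
        using d D(2) U f by (intro lp_coord_le[OF assms(1)] closed_simps) auto
      moreover have "d k = 0"
        using k d by (auto simp: A_def)
      ultimately show ?thesis
        using d by simp
    qed
    then have "\<bar>f k\<bar> powr p \<le> 0"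
      by (metis dense not_le)
    then show ?thesis by simp
  qed
  ultimately show thesis
    using U by (intro that[of A]) (auto simp: lp_on_def)
qed

section \<open>Restriction to subspaces\<close>

context p_normed_space
begin

lemma separable_subspace_mono:
  assumes U: "separable_subspace p U V N" and U': "subspace U'" "U' \<subseteq> U"
  shows "separable_subspace p U' V N"
proof -
  obtain D where "U \<subseteq> V" "countable D" "D \<subseteq> V" "\<forall>x\<in>U. \<forall>e>0. \<exists>d\<in>D. N (x - d) powr p < e"
    using U unfolding separable_subspace_iff by (elim conjE exE) (rule that)
  then show ?thesis
    unfolding separable_subspace_iff using U' by (intro conjI exI[of _ D]) auto
qed

lemma p_normed_space_subspace: "subspace V' \<Longrightarrow> V' \<subseteq> V \<Longrightarrow> p_normed_space p V' N"
  using p_pos p_normed_subspace by (intro p_normed_space.intro)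

text \<open>A dense set chosen inside \<open>U\<close> is available in both ambient spaces.\<close>

lemma separable_subspace_relative:
  assumes "subspace V'" "V' \<subseteq> V" "U \<subseteq> V'"
  shows "separable_subspace p U V' N \<longleftrightarrow> separable_subspace p U V N"
proof -
  interpret V': p_normed_space p V' N
    using assms(1,2) by (rule p_normed_space_subspace)
  show ?thesis
  proof
    assume *: "separable_subspace p U V' N"
    then have "subspace U"
      by (simp add: V'.separable_subspace_iff)
    moreover obtain D where "countable D" "D \<subseteq> U" "\<forall>x\<in>U. \<forall>e>0. \<exists>d\<in>D. N (x - d) powr p < e"
      using V'.separable_subspace_dense[OF *] by (elim exE conjE) (rule that)
    ultimately show "separable_subspace p U V N"
      unfolding separable_subspace_iff using assms by (intro conjI exI[of _ D]) auto
  next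
    assume *: "separable_subspace p U V N"
    then have "subspace U"
      by (simp add: separable_subspace_iff)
    moreover obtain D where "countable D" "D \<subseteq> U" "\<forall>x\<in>U. \<forall>e>0. \<exists>d\<in>D. N (x - d) powr p < e"
      using separable_subspace_dense[OF *] by (elim exE conjE) (rule that)
    ultimately show "separable_subspace p U V' N"
      unfolding V'.separable_subspace_iff using assms by (intro conjI exI[of _ D]) auto
  qed
qed

end

lemma subspace_kernel_on:
  assumes "linear_map_on V W T" "subspace V"
  shows "subspace (kernel_on V T)"
  using linear_map_on_0[OF assms] linear_map_onD[OF assms(1)] assms(2)
  by (auto simp: subspace_def kernel_on_def)

lemma bounded_linear_on_subset:
  assumes T: "bounded_linear_on V N W M T" and sub: "V' \<subseteq> V" and into: "T \<in> V' \<rightarrow> W'"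
  shows "bounded_linear_on V' N W' M T"
proof -
  note lin = linear_map_onD[OF bounded_linear_on_imp_linear[OF T]]
  have mem: "x \<in> V" if "x \<in> V'" for x
    using sub that by blast
  obtain C where "\<forall>x\<in>V. M (T x) \<le> C * N x"
    using T by (auto simp: bounded_linear_on_def)
  then show ?thesis
    unfolding bounded_linear_on_def using into
    by (intro conjI ballI allI exI[of _ C]) (simp_all add: mem lin)
qed

section \<open>Kernels of operators on $\ell_p$\<close>

context lp_operators
begin

text \<open>Both complementations of the proof are instances: for \<open>ker Q\<close>,
  \<open>P\<close> is the identity and \<open>B\<close> the first summand; for the SCP,
  \<open>P\<close> projects onto a separable subspace and \<open>B\<close> is countable. The
  operator T with values \<open>t k\<close> satisfies S T = P S and so carries the kernel into
  itself. It is idempotent because it maps into \<open>lp_on p B\<close> and fixes the unit vectors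
  with index in \<open>B\<close>.\<close>

lemma complemented_kernel_lp_on:
  fixes S :: "('i \<Rightarrow> real) \<Rightarrow> 'b" and t :: "'i \<Rightarrow> 'i \<Rightarrow> real"
  assumes S: "bounded_linear_on (lp_space p) (lp_norm p) W M S"
    and P: "bounded_linear_on W M W M P"
    and t: "\<And>k. t k \<in> lp_on p B" "\<And>k. lp_norm p (t k) powr p \<le> C"
    and t_basis: "\<And>k. k \<in> B \<Longrightarrow> t k = basis_vec k"
    and t_lift: "\<And>k. S (t k) = P (S (basis_vec k))"
  shows "complemented_in (kernel_on (lp_space p) S \<inter> lp_on p B) (kernel_on (lp_space p) S) (lp_norm p)"
proof -
  let ?L = "lp_space p :: ('i \<Rightarrow> real) set" and ?K = "kernel_on (lp_space p) S"
  interpret L: lp_operators p ?L "lp_norm p" "TYPE('i)"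
    using cod.p_pos p_le_1 by (intro lp_operators.intro lp_p_normed_space lp_operators_axioms.intro)
  have t_lp: "t k \<in> ?L" for k
    using t(1) lp_on_subset by blast
  obtain T where T: "bounded_linear_on ?L (lp_norm p) ?L (lp_norm p) T" "\<And>k. T (basis_vec k) = t k"
    by (rule L.lp_operator_exists[where s = t, OF lp_p_banach[OF cod.p_pos p_le_1] t_lp t(2)]) (rule that)
  note lin = bounded_linear_on_imp_linear[OF T(1)]
  note restr = restr_bounded_linear[OF cod.p_pos p_le_1, of B]
  note comp = bounded_linear_on_comp[OF dom.p_normed_space_axioms]
  have ST: "S (T f) = P (S f)" if "f \<in> ?L" for f
  proof (rule lp_operator_eqI[OF _ _ _ that])
    show "bounded_linear_on ?L (lp_norm p) W M (\<lambda>f. S (T f))"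
      by (rule comp[OF dom.p_normed_space_axioms cod.p_normed_space_axioms T(1) S])
    show "bounded_linear_on ?L (lp_norm p) W M (\<lambda>f. P (S f))"
      by (rule comp[OF cod.p_normed_space_axioms cod.p_normed_space_axioms S P])
  qed (simp add: T(2) t_lift)
  have range: "restr B (T f) = T f" if "f \<in> ?L" for f
  proof (rule L.lp_operator_eqI[OF _ T(1) _ that])
    show "bounded_linear_on ?L (lp_norm p) ?L (lp_norm p) (\<lambda>f. restr B (T f))"
      by (rule comp[OF dom.p_normed_space_axioms dom.p_normed_space_axioms T(1) restr])
  qed (use t(1) in \<open>simp add: T(2) lp_on_iff\<close>)
  have fixed: "T (restr B f) = restr B f" if "f \<in> ?L" for f
  proof (rule L.lp_operator_eqI[OF _ restr _ that])
    show "bounded_linear_on ?L (lp_norm p) ?L (lp_norm p) (\<lambda>f. T (restr B f))"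
      by (rule comp[OF dom.p_normed_space_axioms dom.p_normed_space_axioms restr T(1)])
    show "T (restr B (basis_vec k)) = restr B (basis_vec k)" for k
      unfolding restr_basis_vec using T(2)[of k] t_basis[of k] linear_map_on_0[OF lin dom.subspace]
      by (simp split: if_split)
  qed
  have into: "T f \<in> ?K \<inter> lp_on p B" if "f \<in> ?K" for f
  proof -
    have f: "f \<in> ?L" "S f = 0"
      using that by (auto simp: kernel_on_def)
    then show ?thesis
      using ST[OF f(1)] range[OF f(1)] linear_map_on_mem[OF lin f(1)]
        linear_map_on_0[OF bounded_linear_on_imp_linear[OF P] cod.subspace]
      by (simp add: kernel_on_def lp_on_iff)
  qed
  have id: "T f = f" if "f \<in> ?K \<inter> lp_on p B" for f
    using that fixed[of f] by (simp add: lp_on_iff)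
  show ?thesis
    unfolding complemented_in_def
  proof (intro exI[of _ T] conjI ballI)
    show "bounded_linear_on ?K (lp_norm p) ?K (lp_norm p) T"
      using into by (intro bounded_linear_on_subset[OF T(1)]) (auto simp: kernel_on_def)
    show "T (T f) = T f" if "f \<in> ?K" for f
      using id into that by blast
    show "T ` ?K = ?K \<inter> lp_on p B"
    proof
      show "T ` ?K \<subseteq> ?K \<inter> lp_on p B"
        using into by blast
      show "?K \<inter> lp_on p B \<subseteq> T ` ?K"
        using id by (metis IntD1 image_eqI subsetI)
    qed
  qed
qed

text \<open>\<open>S_basis\<close> isolates the feature of the second summand on which the SCP
  rests: vectors of small norm are images of unit vectors.\<close>

lemma SCP_kernel:
  fixes S :: "('i \<Rightarrow> real) \<Rightarrow> 'b"
  assumes W: "SCP p W M"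
    and S: "bounded_linear_on (lp_space p) (lp_norm p) W M S"
    and S_basis: "\<And>w. w \<in> W \<Longrightarrow> M w powr p \<le> 2 \<Longrightarrow> \<exists>k. S (basis_vec k) = w"
  shows "SCP p (kernel_on (lp_space p) S) (lp_norm p)"
  unfolding SCP_def
proof (intro allI impI)
  let ?L = "lp_space p :: ('i \<Rightarrow> real) set" and ?K = "kernel_on (lp_space p) S"
  note p = cod.p_pos p_le_1
  note lin = bounded_linear_on_imp_linear[OF S]
  have K: "subspace ?K" "?K \<subseteq> ?L"
    using subspace_kernel_on[OF lin dom.subspace] by (auto simp: kernel_on_def)
  fix U assume U: "separable_subspace p U ?K (lp_norm p)"
  then have UK: "U \<subseteq> ?K"
    by (simp add: separable_subspace_def)
  then have "separable_subspace p U ?L (lp_norm p)"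
    using U dom.separable_subspace_relative[OF K UK] by blast
  then obtain A where A: "countable A" "U \<subseteq> lp_on p A"
    by (rule separable_lp_countable_support[OF p]) (rule that)
  have "separable_subspace p (S ` lp_on p A) W M"
    by (rule separable_subspace_image[OF lp_on_separable[OF p A(1)] S])
  then obtain X where X: "S ` lp_on p A \<subseteq> X" "separable_subspace p X W M" "complemented_in X W M"
    using W unfolding SCP_def by blast
  then obtain P where P: "bounded_linear_on W M W M P" "\<And>w. w \<in> W \<Longrightarrow> P (P w) = P w" "P ` W = X"
    unfolding complemented_in_def by blast
  have X_sub: "subspace X" "X \<subseteq> W"
    using X(2) by (simp_all add: separable_subspace_def)
  have PX: "P w = w" if "w \<in> X" for w
    using that P(2,3) by auto
  obtain D where D: "countable D" "D \<subseteq> X" "\<forall>w\<in>X. \<forall>e>0. \<exists>d\<in>D. M (w - d) powr p < e"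
    using cod.separable_subspace_dense[OF X(2)] by (elim exE conjE) (rule that)
  define idx where "idx d = (SOME k. S (basis_vec k) = d)" for d
  have idx: "S (basis_vec (idx d)) = d" if "d \<in> W" "M d powr p \<le> 2" for d
    unfolding idx_def using S_basis[OF that] by (rule someI_ex)
  \<comment> \<open>The added unit vectors are mapped to points of \<open>D\<close>, hence into
    \<open>X\<close>. Points of larger norm can be left out, since only normalised vectors will be
    approximated.\<close>
  define B where "B = A \<union> idx ` {d \<in> D. M d powr p \<le> 2}"
  have B: "countable B" "A \<subseteq> B"
    using A(1) D(1) by (auto simp: B_def)
  have SB: "S (basis_vec k) \<in> X" if k: "k \<in> B" for k
  proof (cases "k \<in> A")
    case True
    then show ?thesis
      using X(1) basis_vec_lp_on[OF p(1) True] by blast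
  next
    case False
    then obtain d where d: "d \<in> D" "M d powr p \<le> 2" "k = idx d"
      using k by (auto simp: B_def)
    then have "d \<in> X" "d \<in> W"
      using D(2) X_sub(2) by auto
    with d show ?thesis
      using idx[of d] by simp
  qed
  have "S \<in> lp_on p B \<rightarrow> W"
    using linear_map_on_mem[OF lin] lp_on_subset by blast
  then have Sbd: "bounded_linear_on (lp_on p B) (lp_norm p) W M S"
    by (rule bounded_linear_on_subset[OF S lp_on_subset])
  have sepB: "separable_subspace p (lp_on p B) ?L (lp_norm p)"
    by (rule lp_on_separable[OF p B(1)])
  then have subB: "subspace (lp_on p B)"
    by (simp add: separable_subspace_def)
  interpret LB: p_normed_pair p "lp_on p B" "lp_norm p" W M
    by (intro p_normed_pair.intro dom.p_normed_space_subspace subB lp_on_subset cod.p_normed_space_axioms)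
  \<comment> \<open>Here \<open>X\<close> takes the part of \<open>W'\<close>: each correction is a
    multiple of a unit vector that \<open>S\<close> sends into \<open>X\<close>, so the residues do
    not leave \<open>X\<close>.\<close>
  have lift: "\<exists>y\<in>lp_on p B. S y = w \<and> lp_norm p y powr p \<le> 2 * 1 * M w powr p" if "w \<in> X" for w
  proof (rule LB.lift_of_approximate_lift[OF lp_on_p_banach[OF p] Sbd X_sub(2) _ _ that])
    fix w assume w: "w \<in> X"
    then have wW: "w \<in> W"
      using X_sub by blast
    show "\<exists>y\<in>lp_on p B. lp_norm p y powr p \<le> 1 * M w powr p \<and> w - S y \<in> X \<and> M (w - S y) powr p \<le> M w powr p / 2"
    proof (cases "w = 0")
      case True
      then show ?thesis
        using w by (intro bexI[of _ 0]) (auto simp: linear_map_on_0[OF lin dom.subspace])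
    next
      case False
      define F where "F = M w powr p"
      have F: "0 < F"
        unfolding F_def using cod.powr_eq_0_iff[OF wW] False by (metis less_eq_real_def powr_ge_zero)
      \<comment> \<open>Normalises w to a vector u with \<open>M u powr p = 1\<close>. Approximating
        u within 1/2 by some d and scaling back leaves a residue of at most F / 2, while the
        correction has p-th power exactly F, whence the constant 1.\<close>
      define a where "a = F powr (1 / p)"
      have a: "0 < a" "a powr p = F"
        using F p by (simp_all add: a_def powr_powr)
      define u where "u = (1 / a) *\<^sub>R w"
      have w_eq: "w = a *\<^sub>R u"
        using a by (simp add: u_def)
      have u: "u \<in> X" "u \<in> W"
        using subspace_scale[OF X_sub(1) w] X_sub(2) by (auto simp: u_def)
      have Mu: "M u powr p = 1"
        unfolding u_def cod.scale_powr[OF wW] using a F by (simp add: powr_divide flip: F_def)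
      obtain d where d: "d \<in> D" "M (u - d) powr p < 1 / 2"
        using D(3)[rule_format, OF u(1), of "1 / 2"] by auto
      have dX: "d \<in> X" "d \<in> W"
        using d D(2) X_sub by auto
      have "M d powr p \<le> M (d - u) powr p + M u powr p"
        using dX u by (intro cod.le_diff)
      then have d2: "M d powr p \<le> 2"
        using d Mu cod.minus_commute[OF dX(2) u(2)] by simp
      define y where "y = a *\<^sub>R basis_vec (idx d)"
      have basis: "basis_vec (idx d) \<in> lp_on p B"
        using d d2 by (intro basis_vec_lp_on p) (auto simp: B_def)
      have y: "y \<in> lp_on p B"
        unfolding y_def using subB basis by (rule subspace_scale)
      have "lp_norm p y powr p = F"
        unfolding y_def LB.dom.scale_powr[OF basis] using a by (simp add: basis_vec_lp(2)[OF p(1)])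
      moreover have "S y = a *\<^sub>R d"
        unfolding y_def using linear_map_on_scale[OF lin basis_vec_lp(1)[OF p(1)]] idx[OF dX(2) d2] by simp
      then have "w - S y = a *\<^sub>R (u - d)"
        by (simp add: w_eq scaleR_diff_right)
      moreover from this have "M (w - S y) powr p = F * M (u - d) powr p"
        using u dX a by (simp add: cod.scale_powr)
      then have "M (w - S y) powr p \<le> F / 2"
        using d F by simp
      moreover have "a *\<^sub>R (u - d) \<in> X"
        using u dX X_sub(1) by (intro subspace_scale subspace_diff)
      ultimately show ?thesis
        using y by (intro bexI[of _ y]) (simp_all flip: F_def)
    qed
  qed simp_all
  define t where "t k = (if k \<in> B then basis_vec k else
    (SOME y. y \<in> lp_on p B \<and> S y = P (S (basis_vec k)) \<and> lp_norm p y powr p \<le> 2 * 1 * M (P (S (basis_vec k))) powr p))" for k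
  have SL: "S (basis_vec k) \<in> W" for k
    by (rule linear_map_on_mem[OF lin basis_vec_lp(1)[OF p(1)]])
  have t_notin: "t k \<in> lp_on p B \<and> S (t k) = P (S (basis_vec k)) \<and>
      lp_norm p (t k) powr p \<le> 2 * 1 * M (P (S (basis_vec k))) powr p" if "k \<notin> B" for k
  proof -
    have "P (S (basis_vec k)) \<in> X"
      using SL P(3) by blast
    then have "\<exists>y. y \<in> lp_on p B \<and> S y = P (S (basis_vec k)) \<and>
        lp_norm p y powr p \<le> 2 * 1 * M (P (S (basis_vec k))) powr p"
      using lift by blast
    then show ?thesis
      unfolding t_def if_not_P[OF that] by (rule someI_ex)
  qed
  obtain C where C: "0 \<le> C" "\<And>f. f \<in> ?L \<Longrightarrow> M (P (S f)) powr p \<le> C * lp_norm p f powr p"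
    by (rule bounded_linear_onE[OF bounded_linear_on_comp[OF dom.p_normed_space_axioms
          cod.p_normed_space_axioms cod.p_normed_space_axioms S P(1)]]) (rule that)
  have "complemented_in (?K \<inter> lp_on p B) ?K (lp_norm p)"
  proof (rule complemented_kernel_lp_on[OF S P(1)])
    show "t k \<in> lp_on p B" for k
      using t_notin basis_vec_lp_on[OF p(1)] by (cases "k \<in> B") (auto simp: t_def)
    \<comment> \<open>The term 1 bounds the unit vectors kept for k in \<open>B\<close>, and 2 * C
      bounds the lifts; the sum serves both cases.\<close>
    show "lp_norm p (t k) powr p \<le> 1 + 2 * C" for k
    proof (cases "k \<in> B")
      case True
      then show ?thesis
        using C(1) by (simp add: t_def basis_vec_lp(2)[OF p(1)])
    next
      case False
      then show ?thesis
        using t_notin[OF False] C(2)[OF basis_vec_lp(1)[OF p(1), of k]]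
        by (simp add: basis_vec_lp(2)[OF p(1)])
    qed
    show "t k = basis_vec k" if "k \<in> B" for k
      using that by (simp add: t_def)
    \<comment> \<open>For k in \<open>B\<close> this says that \<open>P\<close> fixes
      \<open>S (basis_vec k)\<close>, which lies in \<open>X\<close> by \<open>SB\<close>.\<close>
    show "S (t k) = P (S (basis_vec k))" for k
    proof (cases "k \<in> B")
      case True
      then show ?thesis
        using PX SB by (simp add: t_def)
    qed (use t_notin in blast)
  qed
  moreover have "separable_subspace p (?K \<inter> lp_on p B) ?K (lp_norm p)"
    using dom.separable_subspace_mono[OF sepB subspace_inter[OF K(1) subB] Int_lower2]
      dom.separable_subspace_relative[OF K Int_lower1] by blast
  moreover have "U \<subseteq> ?K \<inter> lp_on p B"
    using UK A(2) lp_on_mono[OF B(2)] by blast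
  ultimately show "\<exists>W. U \<subseteq> W \<and> separable_subspace p W ?K (lp_norm p) \<and> complemented_in W ?K (lp_norm p)"
    by blast
qed

end

section \<open>Transport along a linear isomorphism\<close>

text \<open>Serves to re-encode functions on a sum type as pairs of functions, the type in which the
  theorem asks for the enveloping space. The norm is carried along, so \<open>\<phi>\<close> is an
  isometry and each property transfers by conjugation.\<close>

locale p_normed_iso = p_normed_space p V N
  for p :: real and V :: "'a::real_vector set" and N +
  fixes \<phi> :: "'a \<Rightarrow> 'b::real_vector" and \<psi> :: "'b \<Rightarrow> 'a"
  assumes linear_\<phi>: "linear \<phi>" and linear_\<psi>: "linear \<psi>"
    and \<psi>_\<phi> [simp]: "\<psi> (\<phi> x) = x" and \<phi>_\<psi> [simp]: "\<phi> (\<psi> y) = y"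
begin

lemma image_iff: "y \<in> \<phi> ` A \<longleftrightarrow> \<psi> y \<in> A"
  by (metis \<psi>_\<phi> \<phi>_\<psi> image_iff)

sublocale image: p_normed_space p "\<phi> ` V" "\<lambda>y. N (\<psi> y)"
proof
  have "\<psi> y = 0 \<longleftrightarrow> y = 0" for y
    by (metis \<phi>_\<psi> linear_0 linear_\<phi> linear_\<psi>)
  then show "p_normed p (\<phi> ` V) (\<lambda>y. N (\<psi> y))"
    using p_normed linear_subspace_image[OF linear_\<phi>]
    unfolding p_normed_def by (auto simp: image_iff linear_add[OF linear_\<psi>] linear_scale[OF linear_\<psi>])
qed (rule p_pos)

sublocale fwd: p_normed_pair p V N "\<phi> ` V" "\<lambda>y. N (\<psi> y)" ..

sublocale bwd: p_normed_pair p "\<phi> ` V" "\<lambda>y. N (\<psi> y)" V N ..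

lemma bounded_linear_\<phi>: "bounded_linear_on V N (\<phi> ` V) (\<lambda>y. N (\<psi> y)) \<phi>"
  unfolding bounded_linear_on_def
  by (auto simp: linear_add[OF linear_\<phi>] linear_scale[OF linear_\<phi>] intro: exI[of _ 1])

lemma bounded_linear_\<psi>: "bounded_linear_on (\<phi> ` V) (\<lambda>y. N (\<psi> y)) V N \<psi>"
  unfolding bounded_linear_on_def
  by (auto simp: linear_add[OF linear_\<psi>] linear_scale[OF linear_\<psi>] image_iff
      simp flip: linear_add[OF linear_\<phi>] linear_scale[OF linear_\<phi>] intro!: exI[of _ 1])

lemma p_banach_image:
  assumes "p_banach p V N"
  shows "p_banach p (\<phi> ` V) (\<lambda>y. N (\<psi> y))"
  unfolding image.p_banach_iff
proof (intro allI impI, elim conjE)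
  fix \<sigma> :: "nat \<Rightarrow> 'b"
  assume "range \<sigma> \<subseteq> \<phi> ` V"
  then have mem: "\<psi> (\<sigma> n) \<in> V" for n
    by (simp add: range_subsetD flip: image_iff)
  assume Cauchy: "\<forall>e>0. \<exists>n0. \<forall>m\<ge>n0. \<forall>n\<ge>n0. N (\<psi> (\<sigma> m - \<sigma> n)) powr p < e"
  obtain x where x: "x \<in> V" "(\<lambda>n. N (\<psi> (\<sigma> n) - x) powr p) \<longlonglongrightarrow> 0"
    by (rule Cauchy_limit[OF assms mem Cauchy[rule_format, unfolded linear_diff[OF linear_\<psi>]]])
      (assumption, rule that)
  show "\<exists>y\<in>\<phi> ` V. (\<lambda>n. N (\<psi> (\<sigma> n - y)) powr p) \<longlonglongrightarrow> 0"
    using x by (intro bexI[of _ "\<phi> x"]) (simp_all add: linear_diff[OF linear_\<psi>])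
qed

lemma complemented_in_image:
  assumes "complemented_in U V N"
  shows "complemented_in (\<phi> ` U) (\<phi> ` V) (\<lambda>y. N (\<psi> y))"
proof -
  obtain P where P: "bounded_linear_on V N V N P" "\<And>x. x \<in> V \<Longrightarrow> P (P x) = P x" "P ` V = U"
    using assms unfolding complemented_in_def by blast
  have "bounded_linear_on (\<phi> ` V) (\<lambda>y. N (\<psi> y)) (\<phi> ` V) (\<lambda>y. N (\<psi> y)) (\<lambda>y. \<phi> (P (\<psi> y)))"
    by (rule bounded_linear_on_comp[OF image.p_normed_space_axioms p_normed_space_axioms
          image.p_normed_space_axioms bounded_linear_on_comp[OF image.p_normed_space_axioms
            p_normed_space_axioms p_normed_space_axioms bounded_linear_\<psi> P(1)] bounded_linear_\<phi>])
  moreover have "(\<lambda>y. \<phi> (P (\<psi> y))) ` \<phi> ` V = \<phi> ` U"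
    unfolding image_image using P(3) by auto
  ultimately show ?thesis
    unfolding complemented_in_def using P(2)
    by (intro exI[of _ "\<lambda>y. \<phi> (P (\<psi> y))"]) auto
qed

lemma SCP_image:
  assumes "SCP p V N"
  shows "SCP p (\<phi> ` V) (\<lambda>y. N (\<psi> y))"
  unfolding SCP_def
proof (intro allI impI)
  fix U assume "separable_subspace p U (\<phi> ` V) (\<lambda>y. N (\<psi> y))"
  then have "separable_subspace p (\<psi> ` U) V N"
    by (rule bwd.separable_subspace_image[OF _ bounded_linear_\<psi>])
  then obtain W where W: "\<psi> ` U \<subseteq> W" "separable_subspace p W V N" "complemented_in W V N"
    using assms unfolding SCP_def by blast
  have "U \<subseteq> \<phi> ` W"
    using W(1) by (auto simp: image_iff)
  then show "\<exists>W. U \<subseteq> W \<and> separable_subspace p W (\<phi> ` V) (\<lambda>y. N (\<psi> y)) \<and>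
      complemented_in W (\<phi> ` V) (\<lambda>y. N (\<psi> y))"
    using fwd.separable_subspace_image[OF W(2) bounded_linear_\<phi>] complemented_in_image[OF W(3)] by blast
qed

end

section \<open>The pullback\<close>

lemma isomorphic_spaces_if_isometry:
  assumes V: "subspace V" and lin: "linear_map_on V W T" and bij: "bij_betw T V W"
    and isom: "\<And>x. x \<in> V \<Longrightarrow> M (T x) = N x"
  shows "isomorphic_spaces V N W M"
proof -
  let ?R = "inv_into V T"
  have inj: "inj_on T V" and surj: "T ` V = W"
    using bij by (auto simp: bij_betw_def)
  have RV: "?R y \<in> V" and TR: "T (?R y) = y" if "y \<in> W" for y
    using that surj by (auto simp: inv_into_into f_inv_into_f)
  have RT: "?R (T x) = x" if "x \<in> V" for x
    using inj that by (rule inv_into_f_f)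
  have "bounded_linear_on V N W M T"
    unfolding bounded_linear_on_def using lin isom
    by (auto simp: linear_map_on_def intro: exI[of _ 1])
  moreover have "bounded_linear_on W M V N ?R"
    unfolding bounded_linear_on_def
  proof (intro conjI ballI allI funcsetI exI[of _ 1])
    show "?R y \<in> V" if "y \<in> W" for y
      using that by (rule RV)
    show "?R (y + z) = ?R y + ?R z" if "y \<in> W" "z \<in> W" for y z
      using linear_map_on_add[OF lin RV[OF that(1)] RV[OF that(2)]] RT[of "?R y + ?R z"] that
      by (simp add: TR RV subspace_add[OF V])
    show "?R (a *\<^sub>R y) = a *\<^sub>R ?R y" if "y \<in> W" for a y
      using linear_map_on_scale[OF lin RV[OF that], of a] RT[of "a *\<^sub>R ?R y"] that
      by (simp add: TR RV subspace_scale[OF V])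
    show "N (?R y) \<le> 1 * M y" if "y \<in> W" for y
      using isom[OF RV[OF that]] TR[OF that] by simp
  qed
  ultimately show ?thesis
    unfolding isomorphic_spaces_def using bij by blast
qed

definition embed_left :: "('i \<Rightarrow> real) \<Rightarrow> 'i + 'j \<Rightarrow> real" where
  "embed_left f = case_sum f (\<lambda>_. 0)"

lemma embed_left_lp:
  "(embed_left f :: 'i + 'j \<Rightarrow> real) \<in> lp_space p \<longleftrightarrow> f \<in> lp_space p"
  "lp_norm p (embed_left f :: 'i + 'j \<Rightarrow> real) = lp_norm p f"
proof -
  let ?g = "\<lambda>k. \<bar>(embed_left f :: 'i + 'j \<Rightarrow> real) k\<bar> powr p"
  have off: "?g k = 0" if "k \<in> UNIV - range Inl" for k
    using that by (cases k) (auto simp: embed_left_def)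
  have comp: "?g \<circ> Inl = (\<lambda>i. \<bar>f i\<bar> powr p)"
    by (auto simp: embed_left_def)
  have "?g summable_on UNIV \<longleftrightarrow> ?g summable_on range Inl"
    using off by (intro summable_on_cong_neutral) auto
  then show "(embed_left f :: 'i + 'j \<Rightarrow> real) \<in> lp_space p \<longleftrightarrow> f \<in> lp_space p"
    by (simp add: lp_space_def summable_on_reindex comp)
  have "infsum ?g UNIV = infsum ?g (range Inl)"
    using off by (intro infsum_cong_neutral) auto
  then show "lp_norm p (embed_left f :: 'i + 'j \<Rightarrow> real) = lp_norm p f"
    by (simp add: lp_norm_def infsum_reindex comp)
qed

lemma linear_embed_left: "linear embed_left"
  by (rule linearI) (auto simp: embed_left_def fun_eq_iff scaleR_fun_apply split: sum.split)

lemma embed_left_basis_vec: "embed_left (basis_vec i) = basis_vec (Inl i)"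
  by (auto simp: embed_left_def basis_vec_def fun_eq_iff split: sum.split)

lemma restr_embed_left: "restr (range Inl) (embed_left f) = embed_left f"
  by (auto simp: embed_left_def restr_def fun_eq_iff split: sum.split)

lemma embed_left_Inl: "embed_left f (Inl i) = f i"
  by (simp add: embed_left_def)

lemma embed_left_eq:
  assumes "restr (range Inl) g = g"
  shows "embed_left (\<lambda>i. g (Inl i)) = g"
proof
  fix k
  show "embed_left (\<lambda>i. g (Inl i)) k = g k"
  proof (cases k)
    case (Inr x)
    have "g (Inr x) = restr (range Inl) g (Inr x)"
      by (simp only: assms)
    also have "\<dots> = 0"
      by (auto simp: restr_def)
    finally show ?thesis
      by (simp add: Inr embed_left_def)
  qed (simp add: embed_left_def)
qed

theorem theorem5p1:
  fixes p :: real
    and X :: "'x::real_vector set"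
    and N :: "'x \<Rightarrow> real"
    and Q :: "('i \<Rightarrow> real) \<Rightarrow> 'x"
  assumes "0 < p" "p \<le> 1"
    and "p_banach p X N"
    and "SCP p X N"
    and "has_density_character p X N (cardSuc natLeq)"
    and "quotient_map_on (lp_space p) (lp_norm p) X N Q"
  shows "\<exists>(Y :: (('i \<Rightarrow> real) \<times> ('x \<Rightarrow> real)) set) M Z.
           p_banach p Y M \<and> SCP p Y M \<and> complemented_in Z Y M \<and>
           isomorphic_spaces (kernel_on (lp_space p) Q) (lp_norm p) Z M"
proof -
  let ?L = "lp_space p :: ('i + 'x \<Rightarrow> real) set"
  interpret X: p_normed_space p X N
    using assms(1,3) by (intro p_normed_space.intro) (simp_all add: p_banach_def)
  interpret I: lp_operators p X N "TYPE('i)"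
    using assms(2) by unfold_locales
  interpret K: lp_operators p X N "TYPE('i + 'x)"
    using assms(2) by unfold_locales
  have Q: "bounded_linear_on (lp_space p) (lp_norm p) X N Q"
    using assms(6) by (simp add: quotient_map_on_def)
  note Q_lin = bounded_linear_on_imp_linear[OF Q]
  obtain C where C: "0 \<le> C" "\<And>f. f \<in> lp_space p \<Longrightarrow> N (Q f) powr p \<le> C * lp_norm p f powr p"
    by (rule I.bounded_linear_onE[OF Q]) (rule that)
  obtain C' where C': "0 \<le> C'"
      "\<forall>x\<in>X. \<exists>f\<in>lp_space p. Q f = x \<and> lp_norm p f powr p \<le> C' * N x powr p"
    using I.open_mapping[OF lp_p_banach[OF assms(1,2)] assms(3,6)] by blast
  \<comment> \<open>A choice of lifts with controlled norm, linear or not; linearity arises when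
    their values at the images of unit vectors are extended to an operator.\<close>
  obtain l where l: "\<And>x. x \<in> X \<Longrightarrow> l x \<in> lp_space p \<and> Q (l x) = x \<and>
      lp_norm p (l x) powr p \<le> C' * N x powr p"
    using C'(2) by metis
  \<comment> \<open>The second summand is indexed by the whole type \<open>'x\<close>. The default
    value 0, for indices outside \<open>X\<close> or of large norm, keeps the family bounded and
    inside \<open>X\<close>.\<close>
  define s where "s = case_sum (\<lambda>i. Q (basis_vec i)) (\<lambda>x. if x \<in> X \<and> N x powr p \<le> 2 then x else 0)"
  have s_Inr: "s (Inr x) \<in> X" "N (s (Inr x)) powr p \<le> 2" for x
    by (auto simp: s_def)
  have s_Inl: "s (Inl i) = Q (basis_vec i)" for i
    by (simp add: s_def)
  \<comment> \<open>The images of unit vectors of the first summand are bounded by \<open>C\<close>,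
    the others by 2; the sum serves both.\<close>
  have s: "s k \<in> X" "N (s k) powr p \<le> C + 2" for k
  proof -
    have "s k \<in> X \<and> N (s k) powr p \<le> C + 2"
    proof (cases k)
      case (Inl i)
      then show ?thesis
        using C(2)[OF basis_vec_lp(1)[OF assms(1), of i]]
          linear_map_on_mem[OF Q_lin basis_vec_lp(1)[OF assms(1), of i]]
        by (simp add: s_Inl basis_vec_lp(2)[OF assms(1)])
    next
      case (Inr x)
      then show ?thesis
        using s_Inr[of x] C(1) by simp
    qed
    then show "s k \<in> X" "N (s k) powr p \<le> C + 2"
      by auto
  qed
  obtain S where S: "bounded_linear_on ?L (lp_norm p) X N S" "\<And>k. S (basis_vec k) = s k"
    by (rule K.lp_operator_exists[OF assms(3) s]) (rule that)
  let ?K = "kernel_on ?L S"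
  have embed: "bounded_linear_on (lp_space p) (lp_norm p) ?L (lp_norm p) embed_left"
    unfolding bounded_linear_on_def
    by (auto simp: embed_left_lp linear_add[OF linear_embed_left] linear_scale[OF linear_embed_left]
        intro!: exI[of _ 1])
  have S_embed: "S (embed_left f) = Q f" if "f \<in> lp_space p" for f
  proof (rule I.lp_operator_eqI[OF _ Q _ that])
    show "bounded_linear_on (lp_space p) (lp_norm p) X N (\<lambda>f. S (embed_left f))"
      by (rule bounded_linear_on_comp[OF I.dom.p_normed_space_axioms K.dom.p_normed_space_axioms
            X.p_normed_space_axioms embed S(1)])
  qed (simp add: embed_left_basis_vec S(2) s_Inl)
  have SCP: "SCP p ?K (lp_norm p)"
  proof (rule K.SCP_kernel[OF assms(4) S(1)])
    show "\<exists>k. S (basis_vec k) = x" if "x \<in> X" "N x powr p \<le> 2" for x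
      using that by (intro exI[of _ "Inr x"]) (simp add: S(2) s_def)
  qed
  define t :: "'i + 'x \<Rightarrow> 'i + 'x \<Rightarrow> real" where
    "t = case_sum (\<lambda>i. basis_vec (Inl i)) (\<lambda>x. embed_left (l (s (Inr x))))"
  \<comment> \<open>Writing both cases as one embedded vector shows at once that \<open>t k\<close>
    is supported on the first summand.\<close>
  have t_eq: "t k = embed_left (case k of Inl i \<Rightarrow> basis_vec i | Inr x \<Rightarrow> l (s (Inr x)))" for k
    by (cases k) (simp_all add: t_def embed_left_basis_vec)
  have t_lp: "(case k of Inl i \<Rightarrow> basis_vec i | Inr x \<Rightarrow> l (s (Inr x))) \<in> lp_space p" for k
    using l s_Inr basis_vec_lp(1)[OF assms(1)] by (cases k) auto
  have complemented: "complemented_in (?K \<inter> lp_on p (range Inl)) ?K (lp_norm p)"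
  \<comment> \<open>The identity takes the place of \<open>P\<close>: by \<open>S_embed\<close>, an
    embedded lift has the same image under \<open>S\<close> as the unit vector that it
    replaces.\<close>
  proof (rule K.complemented_kernel_lp_on[OF S(1), of "\<lambda>x. x"])
    show "bounded_linear_on X N X N (\<lambda>x. x)"
      by (auto simp: bounded_linear_on_def intro: exI[of _ 1])
    show "t k \<in> lp_on p (range Inl)" for k
      unfolding t_eq lp_on_iff using t_lp[of k] by (simp add: embed_left_lp restr_embed_left)
    show "lp_norm p (t k) powr p \<le> 1 + C' * 2" for k
    proof (cases k)
      case (Inl i)
      then show ?thesis
        using C'(1) by (simp add: t_def basis_vec_lp(2)[OF assms(1)])
    next
      case (Inr x)
      have "lp_norm p (l (s (Inr x))) powr p \<le> C' * N (s (Inr x)) powr p"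
        using l s_Inr(1) by blast
      also have "\<dots> \<le> C' * 2"
        using s_Inr(2) C'(1) by (rule mult_left_mono)
      finally show ?thesis
        by (simp add: Inr t_def embed_left_lp)
    qed
    show "t k = basis_vec k" if "k \<in> range Inl" for k
      using that by (auto simp: t_def)
    show "S (t k) = S (basis_vec k)" for k
    proof (cases k)
      case (Inr x)
      have "l (s (Inr x)) \<in> lp_space p" "Q (l (s (Inr x))) = s (Inr x)"
        using l s_Inr(1) by auto
      then show ?thesis
        by (simp add: Inr t_def S_embed S(2))
    qed (simp add: t_def)
  qed
  define \<phi> :: "('i + 'x \<Rightarrow> real) \<Rightarrow> ('i \<Rightarrow> real) \<times> ('x \<Rightarrow> real)"
    where "\<phi> f = (\<lambda>i. f (Inl i), \<lambda>x. f (Inr x))" for f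
  define \<psi> :: "('i \<Rightarrow> real) \<times> ('x \<Rightarrow> real) \<Rightarrow> 'i + 'x \<Rightarrow> real"
    where "\<psi> y = case_sum (fst y) (snd y)" for y
  have lin_\<phi>: "linear \<phi>"
    by (rule linearI) (auto simp: \<phi>_def fun_eq_iff scaleR_fun_apply)
  have lin_\<psi>: "linear \<psi>"
    by (rule linearI) (auto simp: \<psi>_def fun_eq_iff scaleR_fun_apply split: sum.split)
  have \<psi>_\<phi>: "\<psi> (\<phi> f) = f" for f
    by (auto simp: \<phi>_def \<psi>_def fun_eq_iff split: sum.split)
  have \<phi>_\<psi>: "\<phi> (\<psi> y) = y" for y
    by (simp add: \<phi>_def \<psi>_def)
  have subK: "subspace ?K"
    by (rule subspace_kernel_on[OF bounded_linear_on_imp_linear[OF S(1)] K.dom.subspace])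
  have "p_normed_space p ?K (lp_norm p)"
    using subK by (rule K.dom.p_normed_space_subspace) (auto simp: kernel_on_def)
  then interpret iso: p_normed_iso p ?K "lp_norm p" \<phi> \<psi>
    using lin_\<phi> lin_\<psi> \<psi>_\<phi> \<phi>_\<psi> by (intro p_normed_iso.intro p_normed_iso_axioms.intro)
  let ?Z = "\<phi> ` (?K \<inter> lp_on p (range Inl))" and ?M = "\<lambda>y. lp_norm p (\<psi> y)"
  \<comment> \<open>A kernel element supported on the first summand is the extension by 0 of some f,
    and \<open>S_embed\<close> turns \<open>S g = 0\<close> into \<open>Q f = 0\<close>.\<close>
  have embed_ker: "embed_left ` kernel_on (lp_space p) Q = ?K \<inter> lp_on p (range Inl)"
  proof
    show "embed_left ` kernel_on (lp_space p) Q \<subseteq> ?K \<inter> lp_on p (range Inl)"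
      by (auto simp: kernel_on_def lp_on_iff embed_left_lp restr_embed_left S_embed)
    show "?K \<inter> lp_on p (range Inl) \<subseteq> embed_left ` kernel_on (lp_space p) Q"
    proof
      fix g assume g: "g \<in> ?K \<inter> lp_on p (range Inl)"
      define f where "f = (\<lambda>i. g (Inl i))"
      have gf: "g = embed_left f"
        unfolding f_def using g by (intro embed_left_eq[symmetric]) (simp add: lp_on_iff)
      then have "f \<in> lp_space p"
        using g by (simp add: kernel_on_def embed_left_lp)
      moreover from this have "Q f = 0"
        using g S_embed[of f] gf by (simp add: kernel_on_def)
      ultimately show "g \<in> embed_left ` kernel_on (lp_space p) Q"
        unfolding gf by (simp add: kernel_on_def)
    qed
  qed
  have "isomorphic_spaces (kernel_on (lp_space p) Q) (lp_norm p) ?Z ?M"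
  proof (rule isomorphic_spaces_if_isometry)
    show "subspace (kernel_on (lp_space p) Q)"
      by (rule subspace_kernel_on[OF Q_lin I.dom.subspace])
    show "linear_map_on (kernel_on (lp_space p) Q) ?Z (\<lambda>f. \<phi> (embed_left f))"
      unfolding embed_ker[symmetric]
      by (auto simp: linear_map_on_def linear_add[OF linear_embed_left] linear_scale[OF linear_embed_left]
          linear_add[OF lin_\<phi>] linear_scale[OF lin_\<phi>])
    have "inj (\<lambda>f. \<phi> (embed_left f))"
      by (rule inj_on_inverseI[of _ "\<lambda>y i. \<psi> y (Inl i)"]) (simp add: \<psi>_\<phi> embed_left_Inl)
    then show "bij_betw (\<lambda>f. \<phi> (embed_left f)) (kernel_on (lp_space p) Q) ?Z"
      unfolding embed_ker[symmetric] image_image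
      by (intro bij_betw_imageI) (auto intro: inj_on_subset)
    show "lp_norm p (\<psi> (\<phi> (embed_left f))) = lp_norm p f" for f
      by (simp add: \<psi>_\<phi> embed_left_lp)
  qed
  moreover have "p_banach p (\<phi> ` ?K) ?M"
    by (rule iso.p_banach_image[OF K.p_banach_kernel[OF lp_p_banach[OF assms(1,2)] S(1)]])
  ultimately show ?thesis
    using iso.SCP_image[OF SCP] iso.complemented_in_image[OF complemented] by blast
qed

end
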